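(* Let $p>1$, let $\Omega\subset\mathbb{R}^n$ be a bounded domain, let $\mathcal{A}:\mathbb{R}^n\times\mathbb{R}^n\to\mathbb{R}^n$ satisfy the structural assumptions described in the context, let $\mathbf{f}\in L^p(\Omega,\mathbb{R}^n)$ be a given vector field, and let $u\in W_0^{1,p}(\Omega)$ be the unique weak solution to $$\operatorname{div}\mathcal{A}(x,\nabla u)=\operatorname{div}(|\mathbf{f}|^{p-2}\mathbf{f})\ \text{ in }\Omega,\qquad u=0\ \text{ on }\partial\Omega.$$ Suppose that $$\int_\Omega|\nabla u|^p\,v(x)\,dx\leq C\big([v]_{\frac{p}{p-1}}\big)\int_\Omega|\mathbf{f}|^p\,v(x)\,dx$$ holds for all weights $v\in A_{\frac{p}{p-1}}$. Then for any $p-1<q<\infty$ there holds $$\int_\Omega|\nabla u|^q\,w(x)\,dx\leq C\big([w]_{\frac{q}{p-1}}\big)\int_\Omega|\mathbf{f}(x)|^q\,w(x)\,dx$$ for all weights $w\in A_{\frac{q}{p-1}}$.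
   Context: Structural assumptions on $\mathcal{A}$: $\mathcal{A}(x,\xi)$ is measurable in $x$ for every $\xi$ and continuous in $\xi$ for a.e. $x\in\mathbb{R}^n$; $\mathcal{A}(x,0)=0$ and $\mathcal{A}(x,\cdot)$ is continuously differentiable away from the origin for a.e. $x$; and there are constants $\Lambda_0,\Lambda_1>0$ such that for every $(\xi,\eta)\in\mathbb{R}^n\times\mathbb{R}^n\setminus\{(0,0)\}$ and a.e. $x\in\mathbb{R}^n$, $$\langle\mathcal{A}(x,\xi)-\mathcal{A}(x,\eta),\xi-\eta\rangle\geq\Lambda_0(|\xi|^2+|\eta|^2)^{\frac{p-2}{2}}|\xi-\eta|^2,\qquad |\mathcal{A}(x,\xi)-\mathcal{A}(x,\eta)|\leq\Lambda_1|\xi-\eta|(|\xi|^2+|\eta|^2)^{\frac{p-2}{2}}.$$ Weak solution: $\int_\Omega\mathcal{A}(x,\nabla u)\cdot\nabla\varphi\,dx=\int_\Omega|\mathbf{f}|^{p-2}\mathbf{f}\cdot\nabla\varphi\,dx$ for all $\varphi\in W_0^{1,p}(\Omega)$. Weights: a weight is a nonnegative function in $L^1_{\rm loc}(\mathbb{R}^n)$. For $1<s<\infty$, $w\in A_s$ if $[w]_s=\sup_B\big(\frac1{|B|}\int_Bw\,dx\big)\big(\frac1{|B|}\int_Bw^{-1/(s-1)}\,dx\big)^{s-1}<\infty$, the supremum being over all balls $B\subset\mathbb{R}^n$. Convention on constants: in the hypothesis, $C(\cdot)$ is a finite nondecreasing function of the weight constant (it gives a bound uniform over weights with $[v]_{p/(p-1)}$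 bounded by a given number); in the conclusion, $C([w]_{q/(p-1)})$ is a constant that depends on $w$ only through (an upper bound for) $[w]_{q/(p-1)}$, and otherwise only on $n,p,q$ and the function $C(\cdot)$ in the hypothesis. *)

theory Defs
  imports "HOL-Analysis.Analysis"
begin

section \<open>Sobolev spaces\<close>

text \<open>Integrals over a set are taken with respect to Lebesgue measure, so that functions on
  a domain are functions on the whole space whose values outside the domain are ignored.\<close>

definition locally_integrable_on ::
    "('a::euclidean_space \<Rightarrow> 'b::{banach, second_countable_topology}) \<Rightarrow> 'a set \<Rightarrow> bool"
  where "locally_integrable_on f S \<longleftrightarrow> (\<forall>K. compact K \<and> K \<subseteq> S \<longrightarrow> set_integrable lebesgue K f)"

definition Lp_on ::
    "'a::euclidean_space set \<Rightarrow> real \<Rightarrow> ('a \<Rightarrow> 'b::{banach, second_countable_topology}) set"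
  where "Lp_on S p = {f. f \<in> borel_measurable (lebesgue_on S) \<and>
                         set_integrable lebesgue S (\<lambda>x. norm (f x) powr p)}"

definition partial_deriv :: "'n::finite \<Rightarrow> (real^'n \<Rightarrow> real) \<Rightarrow> real^'n \<Rightarrow> real"
  where "partial_deriv i \<phi> x = frechet_derivative \<phi> (at x) (axis i 1)"

definition grad :: "(real^'n::finite \<Rightarrow> real) \<Rightarrow> real^'n \<Rightarrow> real^'n"
  where "grad \<phi> x = (\<chi> i. partial_deriv i \<phi> x)"

primrec Ck :: "nat \<Rightarrow> (real^'n::finite \<Rightarrow> real) \<Rightarrow> bool"
  where
    "Ck 0 \<phi> \<longleftrightarrow> continuous_on UNIV \<phi>"
  | "Ck (Suc k) \<phi> \<longleftrightarrow> (\<forall>x. \<phi> differentiable (at x)) \<and> (\<forall>i. Ck k (partial_deriv i \<phi>))"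

text \<open>The smooth functions with compact support in an open set, extended by zero.\<close>

definition test_functions :: "(real^'n::finite) set \<Rightarrow> (real^'n \<Rightarrow> real) set"
  where "test_functions \<Omega> = {\<phi>. (\<forall>k. Ck k \<phi>) \<and>
           compact (closure {x. \<phi> x \<noteq> 0}) \<and> closure {x. \<phi> x \<noteq> 0} \<subseteq> \<Omega>}"

definition has_weak_grad ::
    "(real^'n::finite) set \<Rightarrow> (real^'n \<Rightarrow> real) \<Rightarrow> (real^'n \<Rightarrow> real^'n) \<Rightarrow> bool"
  where "has_weak_grad \<Omega> u g \<longleftrightarrow>
           locally_integrable_on u \<Omega> \<and> locally_integrable_on g \<Omega> \<and>
           (\<forall>\<phi>\<in>test_functions \<Omega>. \<forall>i.
              (LINT x:\<Omega>|lebesgue. u x * partial_deriv i \<phi> x) =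
              - (LINT x:\<Omega>|lebesgue. g x $ i * \<phi> x))"

text \<open>On an open set the weak gradient is unique up to null sets, so the choice of a
  representative does not affect any of the integrals below.\<close>

definition weak_grad :: "(real^'n::finite) set \<Rightarrow> (real^'n \<Rightarrow> real) \<Rightarrow> real^'n \<Rightarrow> real^'n"
  where "weak_grad \<Omega> u = (SOME g. has_weak_grad \<Omega> u g)"

definition sobolev_W1 :: "(real^'n::finite) set \<Rightarrow> real \<Rightarrow> (real^'n \<Rightarrow> real) set"
  where "sobolev_W1 \<Omega> p =
           {u. u \<in> Lp_on \<Omega> p \<and> (\<exists>g. has_weak_grad \<Omega> u g) \<and> weak_grad \<Omega> u \<in> Lp_on \<Omega> p}"

text \<open>The closure of the test functions in the Sobolev space of order one.\<close>

definition sobolev_W1_0 :: "(real^'n::finite) set \<Rightarrow> real \<Rightarrow> (real^'n \<Rightarrow> real) set"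
  where "sobolev_W1_0 \<Omega> p =
           {u \<in> sobolev_W1 \<Omega> p. \<exists>\<phi>. (\<forall>k::nat. \<phi> k \<in> test_functions \<Omega>) \<and>
              (\<lambda>k. \<integral>\<^sup>+x\<in>\<Omega>. ennreal (\<bar>u x - \<phi> k x\<bar> powr p) \<partial>lebesgue) \<longlonglongrightarrow> 0 \<and>
              (\<lambda>k. \<integral>\<^sup>+x\<in>\<Omega>. ennreal (norm (weak_grad \<Omega> u x - grad (\<phi> k) x) powr p) \<partial>lebesgue)
                \<longlonglongrightarrow> 0}"

section \<open>The equation\<close>

definition structural_assumptions ::
    "real \<Rightarrow> (real^'n::finite \<Rightarrow> real^'n \<Rightarrow> real^'n) \<Rightarrow> bool"
  where "structural_assumptions p A \<longleftrightarrow>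
    (\<forall>\<xi>. (\<lambda>x. A x \<xi>) \<in> borel_measurable lebesgue) \<and>
    (AE x in lebesgue. continuous_on UNIV (A x)) \<and>
    (AE x in lebesgue. A x 0 = 0) \<and>
    (AE x in lebesgue. \<exists>D :: real^'n \<Rightarrow> ((real^'n) \<Rightarrow>\<^sub>L (real^'n)).
       (\<forall>\<xi>. \<xi> \<noteq> 0 \<longrightarrow> (A x has_derivative blinfun_apply (D \<xi>)) (at \<xi>)) \<and>
       continuous_on (- {0}) D) \<and>
    (\<exists>\<Lambda>\<^sub>0 \<Lambda>\<^sub>1. 0 < \<Lambda>\<^sub>0 \<and> 0 < \<Lambda>\<^sub>1 \<and>
       (\<forall>\<xi> \<eta>. (\<xi>, \<eta>) \<noteq> (0, 0) \<longrightarrow>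
          (AE x in lebesgue.
             (A x \<xi> - A x \<eta>) \<bullet> (\<xi> - \<eta>)
               \<ge> \<Lambda>\<^sub>0 * ((norm \<xi>)\<^sup>2 + (norm \<eta>)\<^sup>2) powr ((p - 2) / 2) * (norm (\<xi> - \<eta>))\<^sup>2 \<and>
             norm (A x \<xi> - A x \<eta>)
               \<le> \<Lambda>\<^sub>1 * norm (\<xi> - \<eta>) * ((norm \<xi>)\<^sup>2 + (norm \<eta>)\<^sup>2) powr ((p - 2) / 2))))"

definition weak_solution ::
    "real \<Rightarrow> (real^'n::finite) set \<Rightarrow> (real^'n \<Rightarrow> real^'n \<Rightarrow> real^'n) \<Rightarrow>
     (real^'n \<Rightarrow> real^'n) \<Rightarrow> (real^'n \<Rightarrow> real) \<Rightarrow> bool"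
  where "weak_solution p \<Omega> A f u \<longleftrightarrow>
    u \<in> sobolev_W1_0 \<Omega> p \<and>
    (\<forall>\<phi>\<in>sobolev_W1_0 \<Omega> p.
       (LINT x:\<Omega>|lebesgue. A x (weak_grad \<Omega> u x) \<bullet> weak_grad \<Omega> \<phi> x) =
       (LINT x:\<Omega>|lebesgue. (norm (f x) powr (p - 2) *\<^sub>R f x) \<bullet> weak_grad \<Omega> \<phi> x))"

section \<open>Muckenhoupt weights\<close>

definition weight :: "('a::euclidean_space \<Rightarrow> real) \<Rightarrow> bool"
  where "weight w \<longleftrightarrow> (\<forall>x. 0 \<le> w x) \<and> locally_integrable_on w UNIV"

definition ennreal_powr :: "ennreal \<Rightarrow> real \<Rightarrow> ennreal"
  where "ennreal_powr a t = (if a = top then top else ennreal (enn2real a powr t))"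

definition ball_average :: "'a::euclidean_space \<Rightarrow> real \<Rightarrow> ('a \<Rightarrow> ennreal) \<Rightarrow> ennreal"
  where "ball_average c r h =
           (\<integral>\<^sup>+x\<in>ball c r. h x \<partial>lebesgue) / emeasure lebesgue (ball c r)"

text \<open>The negative power of the weight is an inverse taken in the extended reals, so that it
  is infinite at the zeros of the weight; real powers would give zero there.\<close>

definition Ap_const :: "real \<Rightarrow> ('a::euclidean_space \<Rightarrow> real) \<Rightarrow> ennreal"
  where "Ap_const s w =
    (SUP (c, r) \<in> UNIV \<times> {0<..}.
       ball_average c r (\<lambda>x. ennreal (w x)) *
       ennreal_powr (ball_average c r (\<lambda>x. inverse (ennreal (w x powr (1 / (s - 1)))))) (s - 1))"

definition Ap_weights :: "real \<Rightarrow> ('a::euclidean_space \<Rightarrow> real) set"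
  where "Ap_weights s = {w. weight w \<and> Ap_const s w < top}"

text \<open>The weighted inequality for the exponent \<open>q\<close> and all weights of the class \<open>A\<^sub>s\<close>. Both
  integrals may be infinite.\<close>

definition weighted_estimate ::
    "real \<Rightarrow> real \<Rightarrow> (real \<Rightarrow> real) \<Rightarrow> (real^'n::finite) set \<Rightarrow> (real^'n \<Rightarrow> real^'n) \<Rightarrow>
     (real^'n \<Rightarrow> real) \<Rightarrow> bool"
  where "weighted_estimate q s C \<Omega> f u \<longleftrightarrow>
    (\<forall>w\<in>Ap_weights s.
       (\<integral>\<^sup>+x\<in>\<Omega>. ennreal (norm (weak_grad \<Omega> u x) powr q * w x) \<partial>lebesgue)
       \<le> ennreal (C (enn2real (Ap_const s w))) *
          (\<integral>\<^sup>+x\<in>\<Omega>. ennreal (norm (f x) powr q * w x) \<partial>lebesgue))"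

end

theory Submission
  imports Defs
begin

text \<open>
  With \<open>F = |\<nabla>u|\<^sup>p\<^sup>-\<^sup>1\<close> and \<open>G = |f|\<^sup>p\<^sup>-\<^sup>1\<close> the claim is Rubio de Francia's extrapolation theorem, from the
  exponent \<open>r = p / (p - 1)\<close> to \<open>s = q / (p - 1)\<close>. The maximal operator \<open>M\<close> is bounded on \<open>L\<^sup>s(w)\<close> and on
  \<open>L\<^sup>s\<^sup>'(w\<^sup>1\<^sup>-\<^sup>s\<^sup>')\<close> for \<open>w \<in> A\<^sub>s\<close>, so the series \<open>\<Sum>k. M\<^sup>k h / (2K)\<^sup>k\<close> produces \<open>A\<^sub>1\<close> majorants \<open>H\<close> of
  \<open>G\<close> and \<open>a\<close> of the function \<open>F\<^sup>s\<^sup>-\<^sup>1 w\<close> dual to \<open>F\<close>. The hypothesis applied to the weight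
  \<open>H\<^sup>1\<^sup>-\<^sup>r a \<in> A\<^sub>r\<close> and two applications of Hoelder's inequality give the estimate. The boundedness of
  \<open>M\<close> follows from Lerner's pointwise bound of \<open>M\<close> by two maximal operators with respect to the
  doubling measures \<open>w dx\<close> and \<open>w\<^sup>1\<^sup>-\<^sup>s\<^sup>' dx\<close>; these are handled by Vitali's covering lemma and
  interpolation.
\<close>

section \<open>Powers of extended nonnegative reals\<close>

text \<open>The substitution fits because F^r = |\<nabla>u|^p and F^s = |\<nabla>u|^q: in terms of
  \<open>F\<close> and \<open>G\<close>, hypothesis and conclusion live in A_r with exponent r and
  in A_s with exponent s. The hypothesis accepts only weights in A_r, whereas \<open>w\<close> is in
  A_s, so a new weight has to be manufactured from \<open>w\<close>, with an A_r constant controlled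
  by [w]_s alone. That constant turns out to be at most (2 K)^r, where \<open>K\<close> depends only
  on n, s and an upper bound for [w]_s; hence C(.) enters only through its value at (2 K)^r.
  Functions take values in [0,\<infinity>], so no integrability has to be carried along. The price
  is a few degenerate situations: majorants can be infinite on a null set, the zero function has no
  positive majorant, and a weight can vanish (the zero weight lies in A_s since 0 * \<infinity> =
  0). Finally, duality divides by a power of the very integral being estimated, which is therefore
  first made finite by truncation.\<close>

notation ennreal_powr (infixr "powre" 80)

lemma ennreal_powre: "0 \<le> a \<Longrightarrow> ennreal a powre t = ennreal (a powr t)"
  by (simp add: ennreal_powr_def)

text \<open>For every exponent \<open>top\<close> and 0 are fixed points, also for negative ones.
  Negative powers of weights are therefore written with \<open>inverse\<close>, which exchanges 0
  and \<open>top\<close>.\<close>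

lemma top_powre [simp]: "top powre t = top"
  by (simp add: ennreal_powr_def)

lemma zero_powre [simp]: "0 powre t = 0"
  by (simp add: ennreal_powr_def)

lemma one_powre [simp]: "1 powre t = 1"
  by (simp add: ennreal_powr_def)

lemma powre_one [simp]: "x powre 1 = x"
  by (cases x) (auto simp: ennreal_powre)

lemma powre_eq_0_iff [simp]: "x powre t = 0 \<longleftrightarrow> x = 0"
  by (cases x) (auto simp: ennreal_powre)

lemma powre_eq_top_iff [simp]: "x powre t = top \<longleftrightarrow> x = top"
  by (cases x) (auto simp: ennreal_powre)

lemma powre_less_top_iff [simp]: "x powre t < top \<longleftrightarrow> x < top"
  by (simp add: less_top[symmetric])

lemma powre_powre: "(x powre a) powre b = x powre (a * b)"
  by (cases x) (auto simp: ennreal_powre powr_powr)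

lemma powre_mono: "x \<le> y \<Longrightarrow> 0 < t \<Longrightarrow> x powre t \<le> y powre t"
  by (cases x; cases y) (auto simp: ennreal_powre powr_mono2 top_unique)

lemma powre_mult: "0 < t \<Longrightarrow> (x * y) powre t = x powre t * y powre t"
  by (cases x; cases y)
    (auto simp: ennreal_powre powr_mult ennreal_mult_top ennreal_top_mult simp flip: ennreal_mult)

lemma powre_add: "0 < a \<Longrightarrow> 0 < b \<Longrightarrow> x powre (a + b) = x powre a * x powre b"
  by (cases x) (auto simp: ennreal_powre powr_add simp flip: ennreal_mult)

lemma measurable_powre [measurable]:
  assumes [measurable]: "f \<in> borel_measurable M"
  shows "(\<lambda>x. f x powre t) \<in> borel_measurable M"
  unfolding ennreal_powr_def by measurable

lemma conjugate_exponent_gt_1: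
  fixes s s' :: real
  shows "1 < s \<Longrightarrow> 1 / s + 1 / s' = 1 \<Longrightarrow> 1 < s'"
  by (smt (verit) divide_less_eq_1 divide_pos_pos zero_less_divide_iff)

lemma Young_powre:
  assumes "1 < s" "1 / s + 1 / s' = 1"
  shows "x * y \<le> ennreal (1 / s) * x powre s + ennreal (1 / s') * y powre s'"
proof -
  have s': "1 < s'"
    using assms by (rule conjugate_exponent_gt_1)
  show ?thesis
  proof (cases "x = top \<or> y = top")
    case True
    then show ?thesis
      using assms s' by (auto simp: ennreal_mult_top ennreal_eq_0_iff)
  next
    case False
    then obtain a b where ab: "x = ennreal a" "y = ennreal b" "0 \<le> a" "0 \<le> b"
      by (metis ennreal_cases)
    have "a * b \<le> a powr s / s + b powr s' / s'"
      using Youngs_inequality[of s s' a b] assms s' ab by simp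
    then have "ennreal (a * b) \<le> ennreal (1 / s * a powr s + 1 / s' * b powr s')"
      by (intro ennreal_leI) simp
    also have "\<dots> = ennreal (1 / s) * x powre s + ennreal (1 / s') * y powre s'"
      using assms s' ab by (simp add: ennreal_powre flip: ennreal_mult ennreal_plus)
    finally show ?thesis
      using ab by (simp add: ennreal_mult)
  qed
qed

text \<open>Young's inequality is integrated after scaling both factors to norm 1. If one norm is 0,
  the product vanishes almost everywhere; if one is infinite and the other is not 0, the right side
  is infinite.\<close>

lemma nn_integral_Holder:
  assumes s: "1 < s" "1 / s + 1 / s' = 1"
    and [measurable]: "f \<in> borel_measurable M" "g \<in> borel_measurable M"
  shows "(\<integral>\<^sup>+x. f x * g x \<partial>M)
    \<le> (\<integral>\<^sup>+x. f x powre s \<partial>M) powre (1 / s) * (\<integral>\<^sup>+x. g x powre s' \<partial>M) powre (1 / s')"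
    (is "?I \<le> ?A powre _ * ?B powre _")
proof -
  have s': "1 < s'"
    using s by (rule conjugate_exponent_gt_1)
  consider "?A = 0 \<or> ?B = 0" | "?A \<noteq> 0" "?B \<noteq> 0" "?A = top \<or> ?B = top"
    | "?A \<noteq> 0" "?B \<noteq> 0" "?A \<noteq> top" "?B \<noteq> top" by blast
  then show ?thesis
  proof cases
    case 1
    then have "(AE x in M. f x = 0) \<or> (AE x in M. g x = 0)"
      by (auto simp: nn_integral_0_iff_AE)
    then have "AE x in M. f x * g x = 0" by auto
    then have "?I = 0" by (simp add: nn_integral_0_iff_AE)
    then show ?thesis by simp
  next
    case 2
    then show ?thesis by (auto simp: ennreal_mult_top)
  next
    case 3
    then obtain A B where AB: "?A = ennreal A" "?B = ennreal B" "0 < A" "0 < B"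
      by (metis ennreal_cases ennreal_0 order_le_less)
    define a where "a = A powr (1 / s)"
    define b where "b = B powr (1 / s')"
    have ab: "0 < a" "0 < b" using AB by (auto simp: a_def b_def)
    have eq: "f x * g x = ennreal (a * b) * ((ennreal (1 / a) * f x) * (ennreal (1 / b) * g x))" for x
    proof -
      have "ennreal (a * b) * ennreal (1 / a) * ennreal (1 / b) = 1"
        using ab by (simp flip: ennreal_mult)
      then show ?thesis by (metis (no_types, opaque_lifting) mult.assoc mult.left_commute mult_1)
    qed
    have As: "(1 / a) powr s = 1 / A" "(1 / b) powr s' = 1 / B"
      using AB s s' by (auto simp: a_def b_def powr_divide powr_powr)
    have "?I = ennreal (a * b) * (\<integral>\<^sup>+x. (ennreal (1 / a) * f x) * (ennreal (1 / b) * g x) \<partial>M)"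
      by (subst eq, subst nn_integral_cmult) auto
    also have "(\<integral>\<^sup>+x. (ennreal (1 / a) * f x) * (ennreal (1 / b) * g x) \<partial>M) \<le>
      (\<integral>\<^sup>+x. ennreal (1 / s) * (ennreal (1 / a) * f x) powre s
         + ennreal (1 / s') * (ennreal (1 / b) * g x) powre s' \<partial>M)"
      by (intro nn_integral_mono Young_powre s)
    also have "\<dots> = (\<integral>\<^sup>+x. ennreal (1 / (s * A)) * f x powre s
         + ennreal (1 / (s' * B)) * g x powre s' \<partial>M)"
      using s s' ab AB
      by (simp add: powre_mult ennreal_powre As mult.assoc[symmetric] flip: ennreal_mult)
    also have "\<dots> = ennreal (1 / (s * A)) * ?A + ennreal (1 / (s' * B)) * ?B"
      by (subst nn_integral_add) (auto simp: nn_integral_cmult)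
    also have "\<dots> = ennreal (1 / s + 1 / s')"
      using AB s s' by (simp flip: ennreal_mult ennreal_plus)
    finally show ?thesis
      using s AB by (simp add: a_def b_def ennreal_powre ennreal_mult mult_left_mono)
  qed
qed

text \<open>For finite \<open>a\<close> the derivative of l^t is integrated over (0,a); for
  \<open>a = top\<close> the integral exceeds n^t for every n.\<close>

lemma nn_integral_powr_layer_cake:
  assumes "0 < t"
  shows "(\<integral>\<^sup>+l. (if 0 < l \<and> ennreal l < a then ennreal (t * l powr (t - 1)) else 0) \<partial>lborel)
    = a powre t"
proof -
  have "(\<integral>\<^sup>+l. (if 0 < l \<and> ennreal l < a then ennreal (t * l powr (t - 1)) else 0) \<partial>lborel)
    = (\<integral>\<^sup>+l. ennreal (t * l powr (t - 1)) * indicator {l. 0 < l \<and> ennreal l < a} l \<partial>lborel)"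
    by (intro nn_integral_cong) simp
  also have "\<dots> = a powre t"
  proof -
    have fin: "(\<integral>\<^sup>+l. ennreal (t * l powr (t - 1)) * indicator {0<..<r} l \<partial>lborel) = ennreal (r powr t)"
      if r: "0 \<le> r" for r
    proof -
      have 1: "((\<lambda>x. t * x powr (t - 1)) has_integral r powr t) {0..r}"
        using has_integral_mult_right[OF has_integral_powr_from_0[of "t - 1" r], of t] r assms by simp
      then have "((\<lambda>x. t * x powr (t - 1)) has_integral r powr t) {0<..<r}"
        by (simp add: has_integral_Icc_iff_Ioo)
      then show ?thesis
        by (intro nn_integral_has_integral_lebesgue') (use assms in auto)
    qed
    show ?thesis
    proof (cases a)
      case (real r)
      then have "{l. 0 < l \<and> ennreal l < a} = {0<..<r}"
        by (auto simp: ennreal_less_iff)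
      then show ?thesis using fin[of r] real by (simp add: ennreal_powre)
    next
      case top
      have "ennreal (real n powr t) \<le> (\<integral>\<^sup>+l. ennreal (t * l powr (t - 1)) * indicator {l. 0 < l \<and> ennreal l < a} l \<partial>lborel)" for n
        unfolding fin[of "real n", simplified, symmetric]
        by (intro nn_integral_mono) (auto simp: indicator_def top)
      moreover have "(SUP n. ennreal (real n powr t)) = top"
      proof (rule ennreal_SUP_eq_top)
        fix n
        obtain m :: nat where "real n powr (1 / t) \<le> real m" using real_arch_simple by blast
        then have "(real n powr (1 / t)) powr t \<le> real m powr t" using assms by (intro powr_mono2) auto
        then have "real n \<le> real m powr t" using assms by (simp add: powr_powr)
        then show "\<exists>i\<in>UNIV. of_nat n \<le> ennreal (real i powr t)" by (auto intro!: exI[of _ m])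
      qed
      ultimately have "top \<le> (\<integral>\<^sup>+l. ennreal (t * l powr (t - 1)) * indicator {l. 0 < l \<and> ennreal l < a} l \<partial>lborel)"
        by (metis (mono_tags, lifting) SUP_least)
      then show ?thesis by (simp add: top top_unique)
    qed
  qed
  finally show ?thesis .
qed

section \<open>Balls and superlevel sets under Lebesgue measure\<close>

lemma ball_in_sets_lebesgue [measurable]: "ball c r \<in> sets lebesgue"
  by simp

lemma sets_lebesgue_less:
  fixes f :: "'a::euclidean_space \<Rightarrow> ennreal"
  assumes [measurable]: "f \<in> borel_measurable lebesgue"
  shows "{y. l < f y} \<in> sets lebesgue"
proof -
  have "{y \<in> space lebesgue. l < f y} \<in> sets lebesgue" by measurable
  then show ?thesis by simp
qed

lemma set_nn_integral_ball_pos: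
  fixes f :: "'a::euclidean_space \<Rightarrow> ennreal"
  assumes [measurable]: "f \<in> borel_measurable lebesgue" and "\<And>x. 0 < f x" "0 < r"
  shows "0 < (\<integral>\<^sup>+x\<in>ball c r. f x \<partial>lebesgue)"
proof (rule ccontr)
  assume "\<not> ?thesis"
  then have "AE x in lebesgue. f x * indicator (ball c r) x = 0"
    by (simp add: nn_integral_0_iff_AE)
  then have "AE x in lebesgue. x \<notin> ball c r"
    using assms(2) by (auto simp: indicator_def less_le elim!: eventually_mono split: if_splits)
  then have "emeasure lebesgue (ball c r) = 0"
    by (subst (asm) AE_iff_measurable[where N = "ball c r"]) auto
  then show False
    using content_ball_pos[OF assms(3), of c] by (simp add: measure_def)
qed

lemma sigma_finite_lebesgue: "sigma_finite_measure (lebesgue :: 'a::euclidean_space measure)"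
proof
  show "\<exists>A::'a set set. countable A \<and> A \<subseteq> sets lebesgue \<and> \<Union>A = space lebesgue \<and> (\<forall>a\<in>A. emeasure lebesgue a \<noteq> \<infinity>)"
  proof (intro exI[of _ "range (\<lambda>n::nat. ball 0 (real n))"] conjI ballI)
    show "\<Union> (range (\<lambda>n. ball 0 (real n))) = space (lebesgue :: 'a measure)"
      by (auto simp: reals_Archimedean2)
  qed (use emeasure_lborel_ball_finite[of "0::'a"] in \<open>auto simp: less_top[symmetric]\<close>)
qed

section \<open>Maximal functions of doubling weights\<close>

text \<open>The uncentred maximal operator of the measure w dx; \<open>w = (\<lambda>_. 1)\<close>
  gives that of Hardy and Littlewood. Admitting every ball through \<open>x\<close>, not only
  centred ones, bounds the average over a ball by the maximal function at each of its
  points.\<close>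

definition maximal_op :: "('a::euclidean_space \<Rightarrow> ennreal) \<Rightarrow> ('a \<Rightarrow> ennreal) \<Rightarrow> 'a \<Rightarrow> ennreal"
  where "maximal_op w f x = (SUP (c, r) \<in> {(c, r). 0 < r \<and> x \<in> ball c r}.
    (\<integral>\<^sup>+y\<in>ball c r. (f y * w y) \<partial>lebesgue) / (\<integral>\<^sup>+y\<in>ball c r. w y \<partial>lebesgue))"

lemma maximal_op_ge:
  assumes "x \<in> ball c r"
  shows "(\<integral>\<^sup>+y\<in>ball c r. (f y * w y) \<partial>lebesgue) / (\<integral>\<^sup>+y\<in>ball c r. w y \<partial>lebesgue)
    \<le> maximal_op w f x"
proof -
  have "0 < r" using assms by (metis ball_eq_empty empty_iff not_le)
  with assms show ?thesis
    unfolding maximal_op_def by (intro SUP_upper2[of "(c, r)"]) auto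
qed

lemma maximal_op_le:
  assumes "\<And>c r. 0 < r \<Longrightarrow> x \<in> ball c r \<Longrightarrow>
    (\<integral>\<^sup>+y\<in>ball c r. (f y * w y) \<partial>lebesgue) / (\<integral>\<^sup>+y\<in>ball c r. w y \<partial>lebesgue) \<le> b"
  shows "maximal_op w f x \<le> b"
  unfolding maximal_op_def using assms by (auto intro!: SUP_least)

lemma less_maximal_op_iff:
  "l < maximal_op w f x \<longleftrightarrow> (\<exists>c r. 0 < r \<and> x \<in> ball c r \<and>
    l < (\<integral>\<^sup>+y\<in>ball c r. (f y * w y) \<partial>lebesgue) / (\<integral>\<^sup>+y\<in>ball c r. w y \<partial>lebesgue))"
  unfolding maximal_op_def less_SUP_iff by auto

text \<open>A ball that witnesses the inequality at one of its points witnesses it at all of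
  them.\<close>

lemma open_less_maximal_op: "open {x. l < maximal_op w f x}"
proof (subst open_subopen, intro ballI)
  fix x assume "x \<in> {x. l < maximal_op w f x}"
  then obtain c r where "0 < r" "x \<in> ball c r"
    "l < (\<integral>\<^sup>+y\<in>ball c r. (f y * w y) \<partial>lebesgue) / (\<integral>\<^sup>+y\<in>ball c r. w y \<partial>lebesgue)"
    by (auto simp: less_maximal_op_iff)
  then have "ball c r \<subseteq> {x. l < maximal_op w f x}"
    unfolding less_maximal_op_iff by blast
  with \<open>x \<in> ball c r\<close> show "\<exists>T. open T \<and> x \<in> T \<and> T \<subseteq> {x. l < maximal_op w f x}"
    by (metis open_ball)
qed

lemma borel_measurable_maximal_op [measurable]: "maximal_op w f \<in> borel_measurable lebesgue"
  by (rule borel_measurableI_greater) (simp add: open_less_maximal_op borel_open)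

lemma maximal_op_cmult:
  assumes [measurable]: "f \<in> borel_measurable lebesgue" "w \<in> borel_measurable lebesgue"
  shows "maximal_op w (\<lambda>x. c * f x) x = c * maximal_op w f x"
proof -
  have "(\<integral>\<^sup>+y\<in>ball a r. (c * f y * w y) \<partial>lebesgue) = c * (\<integral>\<^sup>+y\<in>ball a r. (f y * w y) \<partial>lebesgue)" for a r
    by (subst nn_integral_cmult[symmetric]) (auto simp: mult.assoc)
  then show ?thesis
    unfolding maximal_op_def by (simp add: SUP_mult_left_ennreal case_prod_unfold ennreal_times_divide)
qed

lemma maximal_op_suminf_le:
  assumes [measurable]: "\<And>i. f i \<in> borel_measurable lebesgue" "w \<in> borel_measurable lebesgue"
  shows "maximal_op w (\<lambda>x. \<Sum>i. f i x) x \<le> (\<Sum>i. maximal_op w (f i) x)"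
proof (rule maximal_op_le)
  fix c r assume "0 < (r::real)" "x \<in> ball c r"
  have "(\<integral>\<^sup>+y\<in>ball c r. ((\<Sum>i. f i y) * w y) \<partial>lebesgue)
    = (\<integral>\<^sup>+y. (\<Sum>i. f i y * w y * indicator (ball c r) y) \<partial>lebesgue)"
    by simp
  also have "\<dots> = (\<Sum>i. \<integral>\<^sup>+y\<in>ball c r. (f i y * w y) \<partial>lebesgue)"
    by (rule nn_integral_suminf) auto
  finally have "(\<integral>\<^sup>+y\<in>ball c r. ((\<Sum>i. f i y) * w y) \<partial>lebesgue) / (\<integral>\<^sup>+y\<in>ball c r. w y \<partial>lebesgue)
    = (\<Sum>i. (\<integral>\<^sup>+y\<in>ball c r. (f i y * w y) \<partial>lebesgue) / (\<integral>\<^sup>+y\<in>ball c r. w y \<partial>lebesgue))"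
    by simp
  also have "\<dots> \<le> (\<Sum>i. maximal_op w (f i) x)"
    by (intro suminf_le maximal_op_ge \<open>x \<in> ball c r\<close>) auto
  finally show "(\<integral>\<^sup>+y\<in>ball c r. ((\<Sum>i. f i y) * w y) \<partial>lebesgue) / (\<integral>\<^sup>+y\<in>ball c r. w y \<partial>lebesgue)
    \<le> (\<Sum>i. maximal_op w (f i) x)" .
qed

text \<open>The dilation factor 5 is the one that Vitali's covering lemma produces.\<close>

locale doubling_weight =
  fixes w :: "'a::euclidean_space \<Rightarrow> ennreal" and D :: real
  assumes measurable_w [measurable]: "w \<in> borel_measurable lebesgue"
    and ball_pos: "0 < r \<Longrightarrow> 0 < (\<integral>\<^sup>+y\<in>ball c r. w y \<partial>lebesgue)"
    and ball_finite: "(\<integral>\<^sup>+y\<in>ball c r. w y \<partial>lebesgue) < top"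
    and D_nonneg: "0 \<le> D"
    and doubling: "0 < r \<Longrightarrow>
      (\<integral>\<^sup>+y\<in>ball c (5 * r). w y \<partial>lebesgue) \<le> ennreal D * (\<integral>\<^sup>+y\<in>ball c r. w y \<partial>lebesgue)"
begin

text \<open>The part of \<open>f\<close> below height \<open>l\<close> has all its averages at most
  \<open>l\<close>.\<close>

lemma maximal_op_le_add_truncated:
  assumes [measurable]: "f \<in> borel_measurable lebesgue"
  shows "maximal_op w f x \<le> l + maximal_op w (\<lambda>y. f y * indicator {y. l < f y} y) x"
proof (rule maximal_op_le)
  fix c r assume r: "0 < (r::real)" "x \<in> ball c r"
  let ?W = "\<integral>\<^sup>+y\<in>ball c r. w y \<partial>lebesgue"
  have [measurable]: "{y. l < f y} \<in> sets lebesgue"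
    by (intro sets_lebesgue_less assms)
  have "(\<integral>\<^sup>+y\<in>ball c r. (f y * w y) \<partial>lebesgue)
    \<le> (\<integral>\<^sup>+y. l * (w y * indicator (ball c r) y)
        + f y * indicator {y. l < f y} y * w y * indicator (ball c r) y \<partial>lebesgue)"
    by (intro nn_integral_mono) (auto simp: indicator_def not_less intro: mult_right_mono)
  also have "\<dots> = l * ?W + (\<integral>\<^sup>+y\<in>ball c r. (f y * indicator {y. l < f y} y * w y) \<partial>lebesgue)"
    by (subst nn_integral_add) (auto simp: nn_integral_cmult)
  finally have "(\<integral>\<^sup>+y\<in>ball c r. (f y * w y) \<partial>lebesgue) / ?W
    \<le> (l * ?W + (\<integral>\<^sup>+y\<in>ball c r. (f y * indicator {y. l < f y} y * w y) \<partial>lebesgue)) / ?W"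
    by (rule divide_right_mono_ennreal)
  also have "\<dots> = l * ?W / ?W + (\<integral>\<^sup>+y\<in>ball c r. (f y * indicator {y. l < f y} y * w y) \<partial>lebesgue) / ?W"
    by (rule add_divide_distrib_ennreal)
  also have "l * ?W / ?W = l"
    using ball_pos[OF r(1), of c] ball_finite by (intro ennreal_mult_divide_eq) (auto simp: less_top)
  finally show "(\<integral>\<^sup>+y\<in>ball c r. (f y * w y) \<partial>lebesgue) / ?W
    \<le> l + maximal_op w (\<lambda>y. f y * indicator {y. l < f y} y) x"
    using maximal_op_ge[OF r(2)] by (meson add_left_mono order.trans)
qed

lemma emeasure_density_w:
  "S \<in> sets lebesgue \<Longrightarrow> emeasure (density lebesgue w) S = (\<integral>\<^sup>+y\<in>S. w y \<partial>lebesgue)"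
  by (simp add: emeasure_density)

text \<open>Vitali's covering lemma needs bounded radii, hence the truncation at \<open>N\<close>.\<close>

lemma weak_type_truncated:
  assumes [measurable]: "f \<in> borel_measurable lebesgue" and l: "0 < l"
  defines "K \<equiv> \<lambda>N. {(c, r). 0 < r \<and> r \<le> real N \<and>
      ennreal l < (\<integral>\<^sup>+y\<in>ball c r. (f y * w y) \<partial>lebesgue) / (\<integral>\<^sup>+y\<in>ball c r. w y \<partial>lebesgue)}"
  shows "(\<integral>\<^sup>+y\<in>(\<Union>(c, r)\<in>K N. ball c r). w y \<partial>lebesgue) \<le> ennreal (D / l) * (\<integral>\<^sup>+y. f y * w y \<partial>lebesgue)"
proof -
  have radii: "\<And>i. i \<in> K N \<Longrightarrow> 0 < snd i \<and> snd i \<le> real N"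
    by (auto simp: K_def)
  obtain C where C: "countable C" "C \<subseteq> K N"
     "pairwise (\<lambda>i j. disjnt (cball (fst i) (snd i)) (cball (fst j) (snd j))) C"
     and cover: "\<And>i. i \<in> K N \<Longrightarrow> \<exists>j. j \<in> C \<and> \<not> disjnt (cball (fst i) (snd i)) (cball (fst j) (snd j)) \<and>
                        cball (fst i) (snd i) \<subseteq> ball (fst j) (5 * snd j)"
    by (rule Vitali_covering_lemma_cballs_balls[of "K N" snd "real N" fst, OF radii])
      (assumption, rule that)
  \<comment> \<open>\<open>C\<close> may be finite, so indices outside \<open>J\<close> carry the
    empty set. The \<open>Y n\<close> are the selected disjoint balls, and the \<open>X n\<close>
    are their fivefold dilations, which cover.\<close>
  define J where "J = to_nat_on C ` C"
  define X where "X n = (if n \<in> J then case from_nat_into C n of (c, r) \<Rightarrow> ball c (5 * r) else {})" for n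
  define Y where "Y n = (if n \<in> J then case from_nat_into C n of (c, r) \<Rightarrow> ball c r else {})" for n
  have enum: "from_nat_into C n \<in> C" if "n \<in> J" for n
    using that C(1) by (auto simp: J_def)
  have inj: "m = n" if "m \<in> J" "n \<in> J" "from_nat_into C m = from_nat_into C n" for m n
    using that C(1) by (auto simp: J_def)
  have [measurable]: "X n \<in> sets lebesgue" "Y n \<in> sets lebesgue" for n
    by (auto simp: X_def Y_def split: prod.split)
  have disj: "disjoint_family Y"
  proof (unfold disjoint_family_on_def, intro ballI impI)
    fix m n :: nat assume "m \<noteq> n"
    show "Y m \<inter> Y n = {}"
    proof (cases "m \<in> J \<and> n \<in> J")
      case True
      then have "disjnt (cball (fst (from_nat_into C m)) (snd (from_nat_into C m)))
          (cball (fst (from_nat_into C n)) (snd (from_nat_into C n)))"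
        using C(3) enum inj \<open>m \<noteq> n\<close> unfolding pairwise_def by metis
      then have "disjnt (ball (fst (from_nat_into C m)) (snd (from_nat_into C m)))
          (ball (fst (from_nat_into C n)) (snd (from_nat_into C n)))"
        by (meson ball_subset_cball disjnt_subset1 disjnt_subset2)
      then show ?thesis
        using True by (auto simp: Y_def disjnt_def split: prod.split)
    qed (auto simp: Y_def)
  qed
  \<comment> \<open>Each selected ball satisfies l W < \<integral> f w by its membership in
    \<open>K N\<close>; doubling carries this bound over to the dilated ball.\<close>
  have XY: "(\<integral>\<^sup>+y\<in>X n. w y \<partial>lebesgue) \<le> ennreal (D / l) * (\<integral>\<^sup>+y\<in>Y n. (f y * w y) \<partial>lebesgue)" for n
  proof (cases "n \<in> J")
    case True
    obtain c r where cr: "from_nat_into C n = (c, r)" by fastforce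
    let ?W = "\<integral>\<^sup>+y\<in>ball c r. w y \<partial>lebesgue"
    have r: "0 < r" "ennreal l < (\<integral>\<^sup>+y\<in>ball c r. (f y * w y) \<partial>lebesgue) / ?W"
      using enum[OF True] C(2) by (auto simp: cr K_def)
    have W: "?W \<noteq> 0" "?W < top" using ball_pos[OF r(1), of c] ball_finite by auto
    have "ennreal l * ?W \<le> (\<integral>\<^sup>+y\<in>ball c r. (f y * w y) \<partial>lebesgue) / ?W * ?W"
      using r(2) by (intro mult_right_mono) auto
    also have "\<dots> = (\<integral>\<^sup>+y\<in>ball c r. (f y * w y) \<partial>lebesgue)"
      using W by (simp add: ennreal_divide_times)
    finally have "ennreal (D / l) * (ennreal l * ?W) \<le> ennreal (D / l) * (\<integral>\<^sup>+y\<in>ball c r. (f y * w y) \<partial>lebesgue)"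
      by (rule mult_left_mono) simp
    moreover have "ennreal (D / l) * ennreal l = ennreal D"
      using l D_nonneg by (simp flip: ennreal_mult)
    ultimately have "ennreal D * ?W \<le> ennreal (D / l) * (\<integral>\<^sup>+y\<in>ball c r. (f y * w y) \<partial>lebesgue)"
      by (simp only: mult.assoc[symmetric])
    with doubling[OF r(1), of c] show ?thesis
      using True by (auto simp: X_def Y_def cr intro: order.trans)
  qed (simp add: X_def)
  have "(\<Union>(c, r)\<in>K N. ball c r) \<subseteq> (\<Union>n. X n)"
  proof safe
    fix x c r assume "(c, r) \<in> K N" "x \<in> ball c r"
    then obtain j where j: "j \<in> C" "cball c r \<subseteq> ball (fst j) (5 * snd j)"
      using cover[of "(c, r)"] by auto
    moreover from j(2) have "x \<in> ball (fst j) (5 * snd j)"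
      using \<open>x \<in> ball c r\<close> ball_subset_cball by blast
    ultimately have "x \<in> X (to_nat_on C j)"
      using C(1) by (auto simp: X_def J_def split: prod.split)
    then show "x \<in> (\<Union>n. X n)" by blast
  qed
  then have "(\<integral>\<^sup>+y\<in>(\<Union>(c, r)\<in>K N. ball c r). w y \<partial>lebesgue) \<le> (\<integral>\<^sup>+y\<in>(\<Union>n. X n). w y \<partial>lebesgue)"
    by (intro nn_integral_mono mult_left_mono) (auto simp: indicator_def)
  also have "\<dots> = emeasure (density lebesgue w) (\<Union>n. X n)"
    by (subst emeasure_density_w) auto
  also have "\<dots> \<le> (\<Sum>n. emeasure (density lebesgue w) (X n))"
    by (intro emeasure_subadditive_countably) auto
  also have "\<dots> \<le> (\<Sum>n. ennreal (D / l) * emeasure (density lebesgue (\<lambda>y. f y * w y)) (Y n))"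
    using XY by (intro suminf_le) (auto simp: emeasure_density)
  also have "\<dots> = ennreal (D / l) * emeasure (density lebesgue (\<lambda>y. f y * w y)) (\<Union>n. Y n)"
    using disj by (simp add: suminf_emeasure image_subset_iff)
  also have "\<dots> \<le> ennreal (D / l) * emeasure (density lebesgue (\<lambda>y. f y * w y)) UNIV"
    by (intro mult_left_mono emeasure_mono) auto
  finally show ?thesis
    by (simp add: emeasure_density)
qed

text \<open>The superlevel set is the increasing union of the sets covered by balls of radius at
  most N, and the truncated bound does not depend on N.\<close>

lemma weak_type:
  assumes [measurable]: "f \<in> borel_measurable lebesgue" and l: "0 < l"
  shows "(\<integral>\<^sup>+y\<in>{y. ennreal l < maximal_op w f y}. w y \<partial>lebesgue)
    \<le> ennreal (D / l) * (\<integral>\<^sup>+y. f y * w y \<partial>lebesgue)"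
proof -
  define K where "K N = {(c, r). 0 < r \<and> r \<le> real N \<and>
      ennreal l < (\<integral>\<^sup>+y\<in>ball c r. (f y * w y) \<partial>lebesgue) / (\<integral>\<^sup>+y\<in>ball c r. w y \<partial>lebesgue)}" for N
  define S where "S N = (\<Union>(c, r)\<in>K N. ball c r)" for N
  have [measurable]: "S N \<in> sets lebesgue" for N
  proof -
    have "open (S N)" unfolding S_def by auto
    then show ?thesis by (simp add: borel_open)
  qed
  have "{y. ennreal l < maximal_op w f y} = (\<Union>N. S N)"
  proof safe
    fix y assume "ennreal l < maximal_op w f y"
    then obtain c r where cr: "0 < r" "y \<in> ball c r"
      "ennreal l < (\<integral>\<^sup>+y\<in>ball c r. (f y * w y) \<partial>lebesgue) / (\<integral>\<^sup>+y\<in>ball c r. w y \<partial>lebesgue)"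
      unfolding less_maximal_op_iff by blast
    obtain N :: nat where "r \<le> real N" using real_arch_simple by blast
    with cr show "y \<in> (\<Union>N. S N)" unfolding S_def K_def by blast
  next
    fix y N assume "y \<in> S N"
    then show "ennreal l < maximal_op w f y"
      unfolding S_def K_def less_maximal_op_iff by blast
  qed
  moreover have "incseq S"
    by (auto simp: incseq_def S_def K_def intro: order.trans)
  ultimately have "(\<integral>\<^sup>+y\<in>{y. ennreal l < maximal_op w f y}. w y \<partial>lebesgue)
    = (SUP N. emeasure (density lebesgue w) (S N))"
    by (simp add: SUP_emeasure_incseq image_subset_iff flip: emeasure_density_w)
  also have "\<dots> \<le> ennreal (D / l) * (\<integral>\<^sup>+y. f y * w y \<partial>lebesgue)"
  proof (rule SUP_least)
    fix N
    have "(\<integral>\<^sup>+y\<in>S N. w y \<partial>lebesgue) \<le> ennreal (D / l) * (\<integral>\<^sup>+y. f y * w y \<partial>lebesgue)"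
      unfolding S_def K_def by (rule weak_type_truncated[OF assms])
    then show "emeasure (density lebesgue w) (S N) \<le> ennreal (D / l) * (\<integral>\<^sup>+y. f y * w y \<partial>lebesgue)"
      by (simp add: emeasure_density_w)
  qed
  finally show ?thesis .
qed

text \<open>Marcinkiewicz interpolation between the weak type estimate and the trivial bound by the
  supremum.\<close>

lemma strong_type:
  assumes [measurable]: "f \<in> borel_measurable lebesgue" and t: "1 < t"
  shows "(\<integral>\<^sup>+y. maximal_op w f y powre t * w y \<partial>lebesgue)
    \<le> ennreal (2 powr t * D * t / (t - 1)) * (\<integral>\<^sup>+y. f y powre t * w y \<partial>lebesgue)"
proof -
  interpret lebesgue: sigma_finite_measure "lebesgue :: 'a measure" by (rule sigma_finite_lebesgue)
  interpret pair_sigma_finite "lebesgue :: 'a measure" "lborel :: real measure" ..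
  \<comment> \<open>Halving leaves room for cutting \<open>f\<close> at height l: if M f > 2 l, then
    the part of \<open>f\<close> above l alone has maximal function greater than l.\<close>
  define E where "E l = {y. ennreal l < maximal_op w f y / 2}" for l
  define G where "G l = {y. ennreal l < f y}" for l
  have E_le: "(\<integral>\<^sup>+y\<in>E l. w y \<partial>lebesgue)
    \<le> ennreal (D / l) * (\<integral>\<^sup>+y\<in>G l. (f y * w y) \<partial>lebesgue)" if l: "0 < l" for l
  proof -
    have [measurable]: "G l \<in> sets lebesgue"
      by (simp add: G_def sets_lebesgue_less)
    let ?g = "\<lambda>y. f y * indicator (G l) y"
    have "E l \<subseteq> {y. ennreal l < maximal_op w ?g y}"
    proof safe
      fix y assume "y \<in> E l"
      then have "ennreal l * 2 < maximal_op w f y"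
        unfolding E_def by (metis (no_types, lifting) divide_right_mono_ennreal ennreal_mult_divide_eq
            mem_Collect_eq not_le top_neq_numeral zero_neq_numeral)
      also have "\<dots> \<le> ennreal l + maximal_op w ?g y"
        using maximal_op_le_add_truncated[of f y "ennreal l"] by (simp add: G_def)
      finally show "ennreal l < maximal_op w ?g y"
        by (simp add: mult_2_right ennreal_add_left_cancel_less)
    qed
    then have "(\<integral>\<^sup>+y\<in>E l. w y \<partial>lebesgue) \<le> (\<integral>\<^sup>+y\<in>{y. ennreal l < maximal_op w ?g y}. w y \<partial>lebesgue)"
      by (intro nn_integral_mono mult_left_mono) (auto simp: indicator_def)
    also have "\<dots> \<le> ennreal (D / l) * (\<integral>\<^sup>+y. ?g y * w y \<partial>lebesgue)"
      by (intro weak_type l) auto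
    finally show ?thesis
      by (simp add: mult_ac)
  qed
  have half: "maximal_op w f y powre t = ennreal (2 powr t) * (maximal_op w f y / 2) powre t" for y
  proof -
    have "maximal_op w f y = ennreal 2 * (maximal_op w f y / 2)"
      using ennreal_mult_divide_eq[of 2 "maximal_op w f y"]
      by (simp add: ennreal_times_divide mult.commute)
    then have "maximal_op w f y powre t = (ennreal 2 * (maximal_op w f y / 2)) powre t"
      by simp
    also have "\<dots> = ennreal (2 powr t) * (maximal_op w f y / 2) powre t"
      using t by (subst powre_mult) (auto simp: ennreal_powre simp del: ennreal_numeral)
    finally show ?thesis .
  qed
  define k where "k t l a = (if 0 < l \<and> ennreal l < a then ennreal (t * l powr (t - 1)) else 0)"
    for t l :: real and a
  have [measurable]: "(\<lambda>l. k t l a) \<in> borel_measurable lborel" for t a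
    unfolding k_def by measurable
  have cake: "(\<integral>\<^sup>+l. k t l a * b \<partial>lborel) = a powre t * b" if "0 < t" for t a b
    using nn_integral_powr_layer_cake[OF that] by (subst nn_integral_multc) (auto simp: k_def)
  have "(\<integral>\<^sup>+y. (maximal_op w f y / 2) powre t * w y \<partial>lebesgue)
    = (\<integral>\<^sup>+y. (\<integral>\<^sup>+l. k t l (maximal_op w f y / 2) * w y \<partial>lborel) \<partial>lebesgue)"
    using t by (simp add: cake)
  also have "\<dots> = (\<integral>\<^sup>+l. (\<integral>\<^sup>+y. k t l (maximal_op w f y / 2) * w y \<partial>lebesgue) \<partial>lborel)"
    unfolding k_def by (rule Fubini'[symmetric]) measurable
  also have "\<dots> \<le> (\<integral>\<^sup>+l. (\<integral>\<^sup>+y. k (t - 1) l (f y) * (ennreal (D * t / (t - 1)) * (f y * w y)) \<partial>lebesgue) \<partial>lborel)"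
  proof (rule nn_integral_mono)
    fix l :: real
    have [measurable]: "G l \<in> sets lebesgue" "E l \<in> sets lebesgue"
      by (simp_all add: G_def E_def sets_lebesgue_less)
    show "(\<integral>\<^sup>+y. k t l (maximal_op w f y / 2) * w y \<partial>lebesgue)
      \<le> (\<integral>\<^sup>+y. k (t - 1) l (f y) * (ennreal (D * t / (t - 1)) * (f y * w y)) \<partial>lebesgue)"
    proof (cases "0 < l")
      case True
      \<comment> \<open>The weak type factor 1/l lowers the layer cake density from exponent t to t
        - 1. Integrating in l then gives f^(t-1), which together with the \<open>f\<close> from the
        weak type bound makes f^t; this is the source of t / (t - 1).\<close>
      have coeff: "ennreal (t * l powr (t - 1)) * ennreal (D / l)
        = ennreal ((t - 1) * l powr (t - 1 - 1)) * ennreal (D * t / (t - 1))"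
        using True t D_nonneg by (simp add: powr_diff power2_eq_square mult_ac flip: ennreal_mult)
      have "(\<integral>\<^sup>+y. k t l (maximal_op w f y / 2) * w y \<partial>lebesgue)
        = ennreal (t * l powr (t - 1)) * (\<integral>\<^sup>+y\<in>E l. w y \<partial>lebesgue)"
        using True by (subst nn_integral_cmult[symmetric])
          (auto simp: k_def E_def indicator_def intro!: nn_integral_cong)
      also have "\<dots> \<le> ennreal (t * l powr (t - 1)) * (ennreal (D / l) * (\<integral>\<^sup>+y\<in>G l. (f y * w y) \<partial>lebesgue))"
        by (intro mult_left_mono E_le True) auto
      also have "\<dots> = ennreal ((t - 1) * l powr (t - 1 - 1)) * ennreal (D * t / (t - 1))
          * (\<integral>\<^sup>+y\<in>G l. (f y * w y) \<partial>lebesgue)"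
        unfolding mult.assoc[symmetric] coeff ..
      also have "\<dots> = (\<integral>\<^sup>+y. k (t - 1) l (f y) * (ennreal (D * t / (t - 1)) * (f y * w y)) \<partial>lebesgue)"
        using True by (subst nn_integral_cmult[symmetric])
          (auto simp: k_def G_def indicator_def mult.assoc intro!: nn_integral_cong)
      finally show ?thesis .
    qed (simp add: k_def)
  qed
  also have "\<dots> = (\<integral>\<^sup>+y. (\<integral>\<^sup>+l. k (t - 1) l (f y) * (ennreal (D * t / (t - 1)) * (f y * w y)) \<partial>lborel) \<partial>lebesgue)"
    unfolding k_def by (rule Fubini') measurable
  also have "\<dots> = (\<integral>\<^sup>+y. ennreal (D * t / (t - 1)) * (f y powre t * w y) \<partial>lebesgue)"
  proof (rule nn_integral_cong)
    fix y
    have "f y powre t = f y powre (t - 1) * f y"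
      using t powre_add[of "t - 1" 1 "f y"] by simp
    moreover have "(\<integral>\<^sup>+l. k (t - 1) l (f y) * (ennreal (D * t / (t - 1)) * (f y * w y)) \<partial>lborel)
      = f y powre (t - 1) * (ennreal (D * t / (t - 1)) * (f y * w y))"
      using t by (intro cake) simp
    ultimately show "(\<integral>\<^sup>+l. k (t - 1) l (f y) * (ennreal (D * t / (t - 1)) * (f y * w y)) \<partial>lborel)
      = ennreal (D * t / (t - 1)) * (f y powre t * w y)"
      by (simp only: mult_ac)
  qed
  also have "\<dots> = ennreal (D * t / (t - 1)) * (\<integral>\<^sup>+y. f y powre t * w y \<partial>lebesgue)"
    by (rule nn_integral_cmult) measurable
  finally have *: "(\<integral>\<^sup>+y. (maximal_op w f y / 2) powre t * w y \<partial>lebesgue)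
    \<le> ennreal (D * t / (t - 1)) * (\<integral>\<^sup>+y. f y powre t * w y \<partial>lebesgue)" .
  have "(\<integral>\<^sup>+y. maximal_op w f y powre t * w y \<partial>lebesgue)
    = ennreal (2 powr t) * (\<integral>\<^sup>+y. (maximal_op w f y / 2) powre t * w y \<partial>lebesgue)"
    unfolding half mult.assoc by (rule nn_integral_cmult) measurable
  also have "\<dots> \<le> ennreal (2 powr t) * (ennreal (D * t / (t - 1)) * (\<integral>\<^sup>+y. f y powre t * w y \<partial>lebesgue))"
    by (rule mult_left_mono[OF *]) simp
  also have "\<dots> = ennreal (2 powr t * D * t / (t - 1)) * (\<integral>\<^sup>+y. f y powre t * w y \<partial>lebesgue)"
  proof -
    have "ennreal (2 powr t) * ennreal (D * t / (t - 1)) = ennreal (2 powr t * D * t / (t - 1))"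
    proof -
      have "2 powr t * (D * t / (t - 1)) = 2 powr t * D * t / (t - 1)"
        by (simp only: times_divide_eq_right mult.assoc)
      then show ?thesis
        using ennreal_mult'[of "2 powr t" "D * t / (t - 1)"] by (metis powr_ge_zero)
    qed
    then show ?thesis
      by (simp only: mult.assoc[symmetric])
  qed
  finally show ?thesis .
qed

end

section \<open>Muckenhoupt's theorem\<close>

text \<open>A weight \<open>w \<in> A\<^sub>s\<close> together with its dual weight \<open>v = w\<^sup>1\<^sup>-\<^sup>s\<^sup>'\<close>, in the form that is symmetric
  under exchanging \<open>(s, w)\<close> and \<open>(s', v)\<close>.\<close>

locale muckenhoupt_pair =
  fixes s s' Q :: real and w v :: "'a::euclidean_space \<Rightarrow> ennreal"
  assumes s: "1 < s" "1 / s + 1 / s' = 1" and Q_nonneg: "0 \<le> Q"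
    and measurable_weights [measurable]: "w \<in> borel_measurable lebesgue" "v \<in> borel_measurable lebesgue"
    and dual: "w x powre (1 / s) * v x powre (1 / s') = 1"
    and balls: "0 < r \<Longrightarrow> (\<integral>\<^sup>+y\<in>ball c r. w y \<partial>lebesgue) powre (1 / s) * (\<integral>\<^sup>+y\<in>ball c r. v y \<partial>lebesgue) powre (1 / s')
      \<le> ennreal Q * emeasure lebesgue (ball c r)"
begin

lemma s': "1 < s'"
  using s by (rule conjugate_exponent_gt_1)

lemma s'_eq: "s' = s / (s - 1)"
  using s s' by (simp add: field_simps)

lemma swap: "muckenhoupt_pair s' s Q v w"
proof
  show "1 / s' + 1 / s = 1" using s by simp
  show "v x powre (1 / s') * w x powre (1 / s) = 1" for x using dual[of x] by (simp add: mult.commute)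
  show "(\<integral>\<^sup>+y\<in>ball c r. v y \<partial>lebesgue) powre (1 / s') * (\<integral>\<^sup>+y\<in>ball c r. w y \<partial>lebesgue) powre (1 / s)
      \<le> ennreal Q * emeasure lebesgue (ball c r)" if "0 < r" for c r
    using balls[OF that, of c] by (simp add: mult.commute)
qed (use s' Q_nonneg in auto)

text \<open>A product with a factor 0 or \<open>top\<close> is 0 or \<open>top\<close>, so
  \<open>dual\<close> keeps both weights positive and finite at every point.\<close>

lemma weights_real:
  obtains a b where "w x = ennreal a" "v x = ennreal b" "0 < a" "0 < b" "b = a powr (1 - s')"
proof -
  have nz: "w x \<noteq> 0" "v x \<noteq> 0" "w x \<noteq> top" "v x \<noteq> top"
    using dual[of x] by (auto simp: ennreal_top_mult ennreal_mult_top split: if_splits)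
  then obtain a b where ab: "w x = ennreal a" "v x = ennreal b" "0 < a" "0 < b"
    by (metis ennreal_cases ennreal_0 order_le_less)
  have "a powr (1 / s) * b powr (1 / s') = 1"
    using dual[of x] ab by (simp add: ennreal_powre flip: ennreal_mult)
  then have "b powr (1 / s') = a powr (- (1 / s))"
    using ab by (simp add: powr_minus field_simps)
  then have "(b powr (1 / s')) powr s' = (a powr (- (1 / s))) powr s'"
    by simp
  then have "b = a powr (- (1 / s) * s')"
    using ab s' by (simp add: powr_powr)
  moreover have "- (1 / s) * s' = 1 - s'"
    using s s' by (simp add: field_simps)
  ultimately show thesis using ab that by simp
qed

lemma w_pos: "0 < w x" and w_finite: "w x < top"
  by (metis weights_real ennreal_less_zero_iff ennreal_less_top)+

lemma inverse_powre_mult: "inverse (w x) powre s' * w x = v x"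
proof -
  obtain a b where ab: "w x = ennreal a" "v x = ennreal b" "0 < a" "0 < b" "b = a powr (1 - s')"
    by (rule weights_real)
  have "inverse a powr s' * a = a powr (1 - s')"
    using ab(3) by (simp add: powr_diff inverse_eq_divide powr_divide)
  then show ?thesis
    using ab by (simp add: inverse_ennreal ennreal_powre flip: ennreal_mult)
qed

lemma inverse_mult_w: "inverse (w x) * w x = 1"
  by (rule weights_real[of x]) (simp add: inverse_ennreal flip: ennreal_mult)

lemma ball_w_pos: "0 < r \<Longrightarrow> 0 < (\<integral>\<^sup>+y\<in>ball c r. w y \<partial>lebesgue)"
  by (intro set_nn_integral_ball_pos w_pos) measurable

lemma ball_v_pos: "0 < r \<Longrightarrow> 0 < (\<integral>\<^sup>+y\<in>ball c r. v y \<partial>lebesgue)"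
  by (rule muckenhoupt_pair.ball_w_pos[OF swap])

lemma ball_w_finite: "(\<integral>\<^sup>+y\<in>ball c r. w y \<partial>lebesgue) < top"
proof (cases "0 < r")
  case True
  have "(\<integral>\<^sup>+y\<in>ball c r. w y \<partial>lebesgue) powre (1 / s) * (\<integral>\<^sup>+y\<in>ball c r. v y \<partial>lebesgue) powre (1 / s') < top"
    by (rule le_less_trans[OF balls[OF True, of c]])
      (use emeasure_lborel_ball_finite[of c r] in \<open>simp add: ennreal_mult_less_top\<close>)
  then show ?thesis
    using ball_v_pos[OF True, of c] by (auto simp: ennreal_mult_less_top)
next
  case False
  then show ?thesis by (simp add: ball_empty)
qed

lemma ball_v_finite: "(\<integral>\<^sup>+y\<in>ball c r. v y \<partial>lebesgue) < top"
  by (rule muckenhoupt_pair.ball_w_finite[OF swap])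

text \<open>Hoelder's inequality for 1 = w^(1/s) v^(1/s'); this is the converse of
  \<open>balls\<close>, with constant 1.\<close>

lemma emeasure_ball_le:
  "emeasure lebesgue (ball c r)
    \<le> (\<integral>\<^sup>+y\<in>ball c r. w y \<partial>lebesgue) powre (1 / s) * (\<integral>\<^sup>+y\<in>ball c r. v y \<partial>lebesgue) powre (1 / s')"
proof -
  let ?I = "\<lambda>y. indicator (ball c r) y :: ennreal"
  have "emeasure lebesgue (ball c r) = (\<integral>\<^sup>+y. (w y * ?I y) powre (1 / s) * (v y * ?I y) powre (1 / s') \<partial>lebesgue)"
  proof -
    have "(w y * ?I y) powre (1 / s) * (v y * ?I y) powre (1 / s') = ?I y" for y
      using dual[of y] by (auto simp: indicator_def)
    then show ?thesis by simp
  qed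
  also have "\<dots> \<le> (\<integral>\<^sup>+y. ((w y * ?I y) powre (1 / s)) powre s \<partial>lebesgue) powre (1 / s)
      * (\<integral>\<^sup>+y. ((v y * ?I y) powre (1 / s')) powre s' \<partial>lebesgue) powre (1 / s')"
    by (intro nn_integral_Holder s) measurable
  finally show ?thesis
    using s s' by (simp add: powre_powre)
qed

text \<open>\<open>balls\<close> on the large ball is compared with \<open>emeasure_ball_le\<close>
  on the small one. The volumes differ by 5^d, the \<open>v\<close> mass of the small ball is at
  most that of the large one, and the latter cancels.\<close>

lemma doubling_w: "doubling_weight w ((Q * 5 ^ DIM('a)) powr s)"
proof
  fix c :: 'a and r :: real assume r: "0 < r"
  let ?W = "\<lambda>r. \<integral>\<^sup>+y\<in>ball c r. w y \<partial>lebesgue" and ?V = "\<lambda>r. \<integral>\<^sup>+y\<in>ball c r. v y \<partial>lebesgue"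
  have scale: "emeasure lebesgue (ball c (5 * r)) = ennreal (5 ^ DIM('a)) * emeasure lebesgue (ball c r)"
    using r by (simp add: emeasure_ball power_mult_distrib mult_ac flip: ennreal_mult)
  have "?V r \<le> ?V (5 * r)"
    using r by (intro nn_integral_mono) (auto simp: indicator_def)
  then have V: "?V r powre (1 / s') \<le> ?V (5 * r) powre (1 / s')"
    using s' by (intro powre_mono) auto
  have "?V (5 * r) powre (1 / s') * ?W (5 * r) powre (1 / s)
    \<le> ennreal Q * (ennreal (5 ^ DIM('a)) * emeasure lebesgue (ball c r))"
    using balls[of "5 * r" c] r unfolding scale by (simp add: mult.commute[of "_ powre (1 / s')"])
  also have "\<dots> \<le> ennreal Q * (ennreal (5 ^ DIM('a)) * (?W r powre (1 / s) * ?V (5 * r) powre (1 / s')))"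
    using V by (intro mult_left_mono order.trans[OF emeasure_ball_le]) auto
  also have "\<dots> = ?V (5 * r) powre (1 / s') * (ennreal (Q * 5 ^ DIM('a)) * ?W r powre (1 / s))"
    using Q_nonneg by (simp add: ennreal_mult mult_ac)
  finally have "?W (5 * r) powre (1 / s) \<le> ennreal (Q * 5 ^ DIM('a)) * ?W r powre (1 / s)"
    using ball_v_pos[of "5 * r" c] ball_v_finite[of c "5 * r"] r
    by (subst (asm) ennreal_mult_le_mult_iff) auto
  then have "(?W (5 * r) powre (1 / s)) powre s \<le> (ennreal (Q * 5 ^ DIM('a)) * ?W r powre (1 / s)) powre s"
    using s by (intro powre_mono) auto
  then show "?W (5 * r) \<le> ennreal ((Q * 5 ^ DIM('a)) powr s) * ?W r"
    using s Q_nonneg by (simp add: powre_mult powre_powre ennreal_powre)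
qed (use ball_w_pos ball_w_finite in auto)

lemma doubling_v: "doubling_weight v ((Q * 5 ^ DIM('a)) powr s')"
  by (rule muckenhoupt_pair.doubling_w[OF swap])

text \<open>Lerner's pointwise bound of the maximal function by two weighted maximal functions.\<close>

lemma maximal_op_le_iterated:
  assumes [measurable]: "f \<in> borel_measurable lebesgue"
  shows "maximal_op (\<lambda>_. 1) f x powre s \<le> ennreal (Q powr (s * s')) *
    maximal_op w (\<lambda>y. maximal_op v (\<lambda>z. f z * inverse (v z)) y powre (s - 1) * inverse (w y)) x powre s'"
proof -
  define m where "m = maximal_op v (\<lambda>z. f z * inverse (v z))"
  have [measurable]: "m \<in> borel_measurable lebesgue" unfolding m_def by measurable
  define h where "h y = m y powre (s - 1) * inverse (w y)" for y
  have hw: "h y * w y = m y powre (s - 1)" for y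
    by (simp add: h_def mult.assoc inverse_mult_w)
  let ?M = "maximal_op w h x"
  \<comment> \<open>With I, W, V the integrals of \<open>f\<close>, \<open>w\<close>,
    \<open>v\<close> over the ball and N its volume, (I/N)^(s-1) = (V/N)^(s-1) (I/V)^(s-1). Here I/V
    is the average of f/v for v dx, so it is at most \<open>m\<close> everywhere on the ball.
    Averaging m^(s-1) = h w over the ball gives at most W/N times the maximal function of
    \<open>h\<close>, and \<open>balls\<close> bounds (W/N) (V/N)^(s-1) by Q^s.\<close>
  have claim: "((\<integral>\<^sup>+y\<in>ball c r. (f y * 1) \<partial>lebesgue) / (\<integral>\<^sup>+y\<in>ball c r. 1 \<partial>lebesgue)) powre (s - 1)
    \<le> ennreal (Q powr s) * ?M" if r: "0 < r" "x \<in> ball c r" for c r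
  proof -
    let ?B = "ball c r"
    let ?I = "\<integral>\<^sup>+y\<in>?B. f y \<partial>lebesgue" and ?W = "\<integral>\<^sup>+y\<in>?B. w y \<partial>lebesgue"
      and ?V = "\<integral>\<^sup>+y\<in>?B. v y \<partial>lebesgue" and ?N = "emeasure lebesgue ?B"
    obtain a where a: "?W = ennreal a" "0 < a"
      using ball_w_pos[OF r(1), of c] ball_w_finite[of c r] by (metis ennreal_cases ennreal_less_zero_iff less_irrefl)
    obtain b where b: "?V = ennreal b" "0 < b"
      using ball_v_pos[OF r(1), of c] ball_v_finite[of c r] by (metis ennreal_cases ennreal_less_zero_iff less_irrefl)
    define n where "n = measure lebesgue ?B"
    have n: "?N = ennreal n" "0 < n"
      using content_ball_pos[OF r(1), of c] emeasure_lborel_ball_finite[of c r]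
      by (auto simp: n_def emeasure_eq_ennreal_measure)
    have "a powr (1 / s) * b powr (1 / s') \<le> Q * n"
      using balls[OF r(1), of c] a b n Q_nonneg
      by (simp add: ennreal_powre flip: ennreal_mult)
    then have "(a powr (1 / s) * b powr (1 / s')) powr s \<le> (Q * n) powr s"
      using s by (intro powr_mono2) auto
    moreover have "s / s' = s - 1" using s s' by (simp add: field_simps)
    ultimately have "a * b powr (s - 1) \<le> Q powr s * n powr s"
      using a b n s Q_nonneg by (simp add: powr_mult powr_powr)
    then have const: "a / n * (b / n) powr (s - 1) \<le> Q powr s"
      using n b by (simp add: powr_divide powr_diff field_simps)
    have "?I / ?V \<le> m y" if "y \<in> ?B" for y
    proof -
      have "(\<integral>\<^sup>+y\<in>?B. (f y * inverse (v y) * v y) \<partial>lebesgue) = ?I"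
      proof (rule nn_integral_cong)
        fix y
        have "inverse (v y) * v y = 1"
          by (rule muckenhoupt_pair.inverse_mult_w[OF swap])
        then show "f y * inverse (v y) * v y * indicator ?B y = f y * indicator ?B y"
          by (simp add: mult.assoc)
      qed
      then show ?thesis
        using maximal_op_ge[OF that, of "\<lambda>z. f z * inverse (v z)" v] by (simp add: m_def)
    qed
    then have "(?I / ?V) powre (s - 1) * indicator ?B y \<le> m y powre (s - 1) * indicator ?B y" for y
      using s by (auto simp: indicator_def intro: powre_mono)
    then have "(\<integral>\<^sup>+y\<in>?B. ((?I / ?V) powre (s - 1)) \<partial>lebesgue) \<le> (\<integral>\<^sup>+y\<in>?B. (m y powre (s - 1)) \<partial>lebesgue)"
      by (rule nn_integral_mono)
    also have "\<dots> = (\<integral>\<^sup>+y\<in>?B. (h y * w y) \<partial>lebesgue)"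
      by (simp add: hw)
    also have "\<dots> = (\<integral>\<^sup>+y\<in>?B. (h y * w y) \<partial>lebesgue) / ?W * ?W"
      using a by (simp add: ennreal_divide_times)
    also have "\<dots> \<le> ?M * ennreal a"
      unfolding a(1)[symmetric] by (intro mult_right_mono maximal_op_ge r) simp
    also have "(\<integral>\<^sup>+y\<in>?B. ((?I / ?V) powre (s - 1)) \<partial>lebesgue) = (?I / ?V) powre (s - 1) * ennreal n"
      by (simp add: nn_integral_cmult_indicator n)
    finally have le: "(?I / ?V) powre (s - 1) * ennreal n \<le> ?M * ennreal a" .
    have "inverse (ennreal b) * ennreal (b / n) = inverse (ennreal n)"
      using b n by (simp add: inverse_ennreal field_simps flip: ennreal_mult)
    then have "?I / ?N = ?I / ?V * ennreal (b / n)"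
      by (simp add: b n divide_ennreal_def mult.assoc)
    then have "(?I / ?N) powre (s - 1) = (?I / ?V) powre (s - 1) * ennreal ((b / n) powr (s - 1))"
      using b n s by (simp add: powre_mult ennreal_powre)
    also have "ennreal ((b / n) powr (s - 1)) = ennreal n * ennreal ((b / n) powr (s - 1) / n)"
      using n by (simp flip: ennreal_mult)
    also have "(?I / ?V) powre (s - 1) * (ennreal n * ennreal ((b / n) powr (s - 1) / n))
      = ((?I / ?V) powre (s - 1) * ennreal n) * ennreal ((b / n) powr (s - 1) / n)"
      by (simp only: mult.assoc)
    also have "\<dots> \<le> (?M * ennreal a) * ennreal ((b / n) powr (s - 1) / n)"
      by (intro mult_right_mono le) simp
    also have "\<dots> = ?M * ennreal (a / n * (b / n) powr (s - 1))"
      using a n by (simp add: mult.assoc flip: ennreal_mult)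
    also have "\<dots> \<le> ?M * ennreal (Q powr s)"
      by (intro mult_left_mono ennreal_leI const) simp
    finally show ?thesis
      by (simp add: mult.commute)
  qed
  have "maximal_op (\<lambda>_. 1) f x \<le> (ennreal (Q powr s) * ?M) powre (1 / (s - 1))"
  proof (rule maximal_op_le)
    fix c r assume r: "0 < (r::real)" "x \<in> ball c r"
    show "(\<integral>\<^sup>+y\<in>ball c r. (f y * 1) \<partial>lebesgue) / (\<integral>\<^sup>+y\<in>ball c r. 1 \<partial>lebesgue)
      \<le> (ennreal (Q powr s) * ?M) powre (1 / (s - 1))"
      using powre_mono[OF claim[OF r], of "1 / (s - 1)"] s by (simp add: powre_powre)
  qed
  then have "maximal_op (\<lambda>_. 1) f x powre s \<le> ((ennreal (Q powr s) * ?M) powre (1 / (s - 1))) powre s"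
    using s by (intro powre_mono) auto
  also have "\<dots> = (ennreal (Q powr s) * ?M) powre s'"
    by (simp add: powre_powre s'_eq)
  also have "\<dots> = ennreal (Q powr (s * s')) * ?M powre s'"
    using s' by (simp add: powre_mult ennreal_powre powr_powr)
  finally show ?thesis
    by (simp add: h_def[abs_def] m_def)
qed

text \<open>The constant of the pointwise bound times the two strong type constants, for
  \<open>w\<close> at exponent s' and for \<open>v\<close> at exponent s. The product is symmetric
  in (s, s'), so the same number serves the dual weight.\<close>

definition bound :: real
  where "bound = Q powr (s * s') * (2 powr s' * (Q * 5 ^ DIM('a)) powr s * s' / (s' - 1))
    * (2 powr s * (Q * 5 ^ DIM('a)) powr s' * s / (s - 1))"

text \<open>The strong type estimate is applied first for w dx and then for v dx. The powers in
  \<open>h\<close> and \<open>g\<close> are such that h^s' w = (M_v g)^s v and g^s v = f^s w, which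
  brings back the original norm.\<close>

theorem maximal_op_bounded:
  assumes [measurable]: "f \<in> borel_measurable lebesgue"
  shows "(\<integral>\<^sup>+x. maximal_op (\<lambda>_. 1) f x powre s * w x \<partial>lebesgue)
    \<le> ennreal bound * (\<integral>\<^sup>+x. f x powre s * w x \<partial>lebesgue)"
proof -
  define g where "g z = f z * inverse (v z)" for z
  define h where "h y = maximal_op v g y powre (s - 1) * inverse (w y)" for y
  define A where "A = 2 powr s' * (Q * 5 ^ DIM('a)) powr s * s' / (s' - 1)"
  define B where "B = 2 powr s * (Q * 5 ^ DIM('a)) powr s' * s / (s - 1)"
  have [measurable]: "g \<in> borel_measurable lebesgue" "h \<in> borel_measurable lebesgue"
    unfolding g_def h_def by measurable
  have AB: "0 \<le> A" "0 \<le> B" using s s' by (auto simp: A_def B_def)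
  have "(\<integral>\<^sup>+x. maximal_op (\<lambda>_. 1) f x powre s * w x \<partial>lebesgue)
    \<le> (\<integral>\<^sup>+x. ennreal (Q powr (s * s')) * (maximal_op w h x powre s' * w x) \<partial>lebesgue)"
  proof (rule nn_integral_mono)
    fix x
    show "maximal_op (\<lambda>_. 1) f x powre s * w x \<le> ennreal (Q powr (s * s')) * (maximal_op w h x powre s' * w x)"
      using mult_right_mono[OF maximal_op_le_iterated[OF assms, of x], of "w x"]
      by (simp add: mult.assoc g_def[abs_def] h_def[abs_def])
  qed
  also have "\<dots> = ennreal (Q powr (s * s')) * (\<integral>\<^sup>+x. maximal_op w h x powre s' * w x \<partial>lebesgue)"
    by (rule nn_integral_cmult) measurable
  also have "\<dots> \<le> ennreal (Q powr (s * s')) * (ennreal A * (\<integral>\<^sup>+x. h x powre s' * w x \<partial>lebesgue))"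
    unfolding A_def using s' by (intro mult_left_mono doubling_weight.strong_type[OF doubling_w]) auto
  also have "(\<integral>\<^sup>+x. h x powre s' * w x \<partial>lebesgue) = (\<integral>\<^sup>+x. maximal_op v g x powre s * v x \<partial>lebesgue)"
  proof (rule nn_integral_cong)
    fix x
    have "(s - 1) * s' = s" using s by (simp add: s'_eq)
    then have "h x powre s' = maximal_op v g x powre s * inverse (w x) powre s'"
      using s' by (simp add: h_def powre_mult powre_powre)
    then show "h x powre s' * w x = maximal_op v g x powre s * v x"
      using inverse_powre_mult[of x] by (simp add: mult.assoc)
  qed
  also have "ennreal (Q powr (s * s')) * (ennreal A * (\<integral>\<^sup>+x. maximal_op v g x powre s * v x \<partial>lebesgue))
    \<le> ennreal (Q powr (s * s')) * (ennreal A * (ennreal B * (\<integral>\<^sup>+x. g x powre s * v x \<partial>lebesgue)))"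
    unfolding B_def using s by (intro mult_left_mono doubling_weight.strong_type[OF doubling_v]) auto
  also have "(\<integral>\<^sup>+x. g x powre s * v x \<partial>lebesgue) = (\<integral>\<^sup>+x. f x powre s * w x \<partial>lebesgue)"
  proof (rule nn_integral_cong)
    fix x
    show "g x powre s * v x = f x powre s * w x"
      using s muckenhoupt_pair.inverse_powre_mult[OF swap, of x] by (simp add: g_def powre_mult mult.assoc)
  qed
  finally show ?thesis
    using AB unfolding bound_def A_def[symmetric] B_def[symmetric]
    by (simp add: ennreal_mult mult.assoc)
qed

end

lemma (in muckenhoupt_pair) bound_swap: "muckenhoupt_pair.bound TYPE('a) s' s Q = bound"
  by (simp add: bound_def muckenhoupt_pair.bound_def[OF swap] mult_ac)

section \<open>The Rubio de Francia algorithm\<close>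

lemma suminf_half_powers: "(\<Sum>k. ennreal ((1 / 2) ^ k)) = 2"
  using suminf_geometric[of "1 / 2 :: real"] by (subst suminf_ennreal2) auto

text \<open>Hoelder's inequality for the masses 2^(-k), whose total 2 contributes 2^(s/s') =
  2^(s-1). It takes the place of Minkowski's inequality when a series is estimated in norm.\<close>

lemma Jensen_geometric:
  assumes s: "1 < s"
  shows "(\<Sum>k. ennreal ((1 / 2) ^ k) * b k) powre s
    \<le> ennreal (2 powr (s - 1)) * (\<Sum>k. ennreal ((1 / 2) ^ k) * b k powre s)"
proof -
  define s' where "s' = s / (s - 1)"
  have s': "1 / s + 1 / s' = 1" "0 < s'"
    using s by (auto simp: s'_def field_simps)
  let ?c = "\<lambda>k. ennreal ((1 / 2) ^ k)"
  have "(\<Sum>k. ?c k * b k) = (\<Sum>k. (?c k powre (1 / s) * b k) * ?c k powre (1 / s'))"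
  proof (rule suminf_cong)
    fix k
    have "?c k = ?c k powre (1 / s) * ?c k powre (1 / s')"
      using s s' powre_add[of "1 / s" "1 / s'" "?c k"] by simp
    then show "?c k * b k = (?c k powre (1 / s) * b k) * ?c k powre (1 / s')"
      by (metis mult.assoc mult.commute)
  qed
  also have "\<dots> = (\<integral>\<^sup>+k. (?c k powre (1 / s) * b k) * ?c k powre (1 / s') \<partial>count_space UNIV)"
    by (simp add: nn_integral_count_space_nat)
  also have "\<dots> \<le> (\<integral>\<^sup>+k. (?c k powre (1 / s) * b k) powre s \<partial>count_space UNIV) powre (1 / s)
    * (\<integral>\<^sup>+k. (?c k powre (1 / s')) powre s' \<partial>count_space UNIV) powre (1 / s')"
    using s s' by (intro nn_integral_Holder) auto
  also have "\<dots> = (\<Sum>k. ?c k * b k powre s) powre (1 / s) * 2 powre (1 / s')"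
    using s s' suminf_half_powers by (simp add: nn_integral_count_space_nat powre_mult powre_powre)
  finally have "(\<Sum>k. ?c k * b k) powre s
    \<le> ((\<Sum>k. ?c k * b k powre s) powre (1 / s) * 2 powre (1 / s')) powre s"
    using s by (intro powre_mono) auto
  also have "\<dots> = (\<Sum>k. ?c k * b k powre s) * 2 powre (s / s')"
    using s by (simp add: powre_mult powre_powre)
  also have "2 powre (s / s') = ennreal (2 powr (s - 1))"
    using s ennreal_powre[of 2 "s - 1"] by (simp add: s'_def)
  finally show ?thesis
    by (simp add: mult.commute)
qed

lemma ennreal_suminf_Suc_le: "(\<Sum>k. f (Suc k)) \<le> (\<Sum>k. f k :: ennreal)"
  using suminf_offset[of f 1] by simp

lemma maximal_op_mono: "(\<And>x. f x \<le> g x) \<Longrightarrow> maximal_op w f x \<le> maximal_op w g x"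
  unfolding maximal_op_def
  by (intro SUP_subset_mono) (auto intro!: divide_right_mono_ennreal nn_integral_mono mult_right_mono)

lemma AE_zero_if_zero_on_balls:
  fixes f :: "'a::euclidean_space \<Rightarrow> ennreal"
  assumes "\<And>n. AE y in lebesgue. f y * indicator (ball x (real (Suc n))) y = 0"
  shows "AE y in lebesgue. f y = 0"
proof -
  have "AE y in lebesgue. \<forall>n. f y * indicator (ball x (real (Suc n))) y = 0"
    using assms by (subst AE_all_countable) blast
  then show ?thesis
  proof (rule eventually_mono)
    fix y assume *: "\<forall>n. f y * indicator (ball x (real (Suc n))) y = 0"
    obtain n :: nat where "dist x y < real n" using reals_Archimedean2 by blast
    then have "y \<in> ball x (real (Suc n))" by simp
    with * show "f y = 0" by (metis indicator_simps(1) mult.right_neutral)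
  qed
qed

text \<open>A sufficiently large ball about \<open>x\<close> catches some of the mass of
  \<open>f\<close>, so positivity holds at every point and not merely almost everywhere.\<close>

lemma maximal_op_pos:
  assumes [measurable]: "f \<in> borel_measurable lebesgue" and "\<not> (AE x in lebesgue. f x = 0)"
  shows "0 < maximal_op (\<lambda>_. 1) f x"
proof (rule ccontr)
  assume "\<not> ?thesis"
  then have zero: "maximal_op (\<lambda>_. 1) f x = 0" by simp
  have "AE y in lebesgue. f y * indicator (ball x (real (Suc n))) y = 0" for n
  proof -
    have "(\<integral>\<^sup>+y\<in>ball x (real (Suc n)). (f y * 1) \<partial>lebesgue) / (\<integral>\<^sup>+y\<in>ball x (real (Suc n)). 1 \<partial>lebesgue) \<le> 0"
      unfolding zero[symmetric] by (rule maximal_op_ge) simp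
    moreover have "(\<integral>\<^sup>+y\<in>ball x (real (Suc n)). 1 \<partial>lebesgue) \<noteq> top"
      using emeasure_lborel_ball_finite[of x "real (Suc n)"] by simp
    ultimately have "(\<integral>\<^sup>+y\<in>ball x (real (Suc n)). f y \<partial>lebesgue) = 0"
      by simp
    then show ?thesis by (simp add: nn_integral_0_iff_AE)
  qed
  then have "AE y in lebesgue. f y = 0"
    by (rule AE_zero_if_zero_on_balls)
  with assms(2) show False by simp
qed

definition rubio_de_francia :: "real \<Rightarrow> ('a::euclidean_space \<Rightarrow> ennreal) \<Rightarrow> 'a \<Rightarrow> ennreal"
  where "rubio_de_francia K f x =
    (\<Sum>k. ennreal ((1 / (2 * K)) ^ k) * (maximal_op (\<lambda>_. 1) ^^ k) f x)"

lemma measurable_maximal_op_iterate [measurable]: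
  "f \<in> borel_measurable lebesgue \<Longrightarrow> (maximal_op w ^^ k) f \<in> borel_measurable lebesgue"
  by (cases k) auto

lemma measurable_rubio_de_francia [measurable]:
  assumes [measurable]: "f \<in> borel_measurable lebesgue"
  shows "rubio_de_francia K f \<in> borel_measurable lebesgue"
  unfolding rubio_de_francia_def[abs_def] by measurable

lemma rubio_de_francia_ge: "f x \<le> rubio_de_francia K f x"
  using sum_le_suminf[OF summableI, of "{0}" "\<lambda>k. ennreal ((1 / (2 * K)) ^ k) * (maximal_op (\<lambda>_. 1) ^^ k) f x"]
  by (simp add: rubio_de_francia_def)

text \<open>Applying the operator termwise shifts the series by one index, and the missing power of
  1 / (2 K) becomes the factor in front. This is the A_1 condition with constant 2 K.\<close>

lemma maximal_op_rubio_de_francia: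
  assumes [measurable]: "f \<in> borel_measurable lebesgue" and K: "0 < K"
  shows "maximal_op (\<lambda>_. 1) (rubio_de_francia K f) x \<le> ennreal (2 * K) * rubio_de_francia K f x"
proof -
  let ?M = "maximal_op (\<lambda>_. 1)"
  let ?c = "\<lambda>k. ennreal ((1 / (2 * K)) ^ k)"
  have "?M (rubio_de_francia K f) x \<le> (\<Sum>k. ?M (\<lambda>x. ?c k * (?M ^^ k) f x) x)"
    unfolding rubio_de_francia_def[abs_def] by (rule maximal_op_suminf_le) measurable
  also have "\<dots> = (\<Sum>k. ennreal (2 * K) * (?c (Suc k) * (?M ^^ Suc k) f x))"
  proof (rule suminf_cong)
    fix k
    have "ennreal (2 * K) * ?c (Suc k) = ?c k"
      using K by (simp flip: ennreal_mult)
    then show "?M (\<lambda>x. ?c k * (?M ^^ k) f x) x = ennreal (2 * K) * (?c (Suc k) * (?M ^^ Suc k) f x)"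
      by (simp add: maximal_op_cmult mult.assoc[symmetric])
  qed
  also have "\<dots> = ennreal (2 * K) * (\<Sum>k. ?c (Suc k) * (?M ^^ Suc k) f x)"
    by simp
  also have "\<dots> \<le> ennreal (2 * K) * rubio_de_francia K f x"
    unfolding rubio_de_francia_def
    by (intro mult_left_mono ennreal_suminf_Suc_le[of "\<lambda>k. ?c k * (?M ^^ k) f x"]) simp
  finally show ?thesis .
qed

text \<open>Positivity also holds where \<open>f\<close> vanishes, since the majorant dominates M f
  up to the factor 2 K.\<close>

lemma rubio_de_francia_pos:
  assumes [measurable]: "f \<in> borel_measurable lebesgue" and K: "0 < K"
    and "\<not> (AE x in lebesgue. f x = 0)"
  shows "0 < rubio_de_francia K f x"
proof -
  have "0 < maximal_op (\<lambda>_. 1) f x"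
    by (intro maximal_op_pos assms)
  also have "\<dots> \<le> maximal_op (\<lambda>_. 1) (rubio_de_francia K f) x"
    by (intro maximal_op_mono rubio_de_francia_ge)
  also have "\<dots> \<le> ennreal (2 * K) * rubio_de_francia K f x"
    by (intro maximal_op_rubio_de_francia K assms)
  finally show ?thesis
    by (auto simp: ennreal_zero_less_mult_iff)
qed

lemma ball_average_le_maximal_op:
  "x \<in> ball c r \<Longrightarrow> ball_average c r f \<le> maximal_op (\<lambda>_. 1) f x"
  using maximal_op_ge[of x c r f "\<lambda>_. 1"] by (simp add: ball_average_def)

lemma ball_average_rubio_de_francia:
  assumes "f \<in> borel_measurable lebesgue" "0 < K" "x \<in> ball c r"
  shows "ball_average c r (rubio_de_francia K f) \<le> ennreal (2 * K) * rubio_de_francia K f x"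
  using ball_average_le_maximal_op[OF assms(3)] maximal_op_rubio_de_francia[OF assms(1,2)]
  by (rule order.trans)

context muckenhoupt_pair
begin

text \<open>\<open>bound\<close> controls integrals of s-th powers, not norms. Since K \<ge> 1,
  bound \<le> K \<le> K^s, so one \<open>K\<close> bounds the operator norm at both exponents s and
  s' without taking roots.\<close>

lemma maximal_op_iterate_bounded:
  assumes [measurable]: "f \<in> borel_measurable lebesgue" and K: "1 \<le> K" "bound \<le> K"
  shows "(\<integral>\<^sup>+x. (maximal_op (\<lambda>_. 1) ^^ k) f x powre s * w x \<partial>lebesgue)
    \<le> ennreal ((K ^ k) powr s) * (\<integral>\<^sup>+x. f x powre s * w x \<partial>lebesgue)"
proof (induction k)
  case (Suc k)
  have "K powr 1 \<le> K powr s" using K s by (intro powr_mono) auto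
  with K have "bound \<le> K powr s" by simp
  have "(\<integral>\<^sup>+x. (maximal_op (\<lambda>_. 1) ^^ Suc k) f x powre s * w x \<partial>lebesgue)
    \<le> ennreal bound * (\<integral>\<^sup>+x. (maximal_op (\<lambda>_. 1) ^^ k) f x powre s * w x \<partial>lebesgue)"
    using maximal_op_bounded[of "(maximal_op (\<lambda>_. 1) ^^ k) f"] by simp
  also have "\<dots> \<le> ennreal (K powr s) * (\<integral>\<^sup>+x. (maximal_op (\<lambda>_. 1) ^^ k) f x powre s * w x \<partial>lebesgue)"
    using \<open>bound \<le> K powr s\<close> by (intro mult_right_mono ennreal_leI) auto
  also have "\<dots> \<le> ennreal (K powr s) * (ennreal ((K ^ k) powr s) * (\<integral>\<^sup>+x. f x powre s * w x \<partial>lebesgue))"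
    by (intro mult_left_mono Suc) simp
  also have "\<dots> = ennreal ((K ^ Suc k) powr s) * (\<integral>\<^sup>+x. f x powre s * w x \<partial>lebesgue)"
    using K by (simp add: powr_mult ennreal_mult mult.assoc)
  finally show ?case .
qed simp

text \<open>The series is \<Sum> 2^(-k) b_k with b_k = K^(-k) M^k f, and each b_k has norm at most
  that of \<open>f\<close>. The constant 2^s is 2^(s-1) from \<open>Jensen_geometric\<close> times
  the total mass 2.\<close>

lemma rubio_de_francia_bounded:
  assumes [measurable]: "f \<in> borel_measurable lebesgue" and K: "1 \<le> K" "bound \<le> K"
  shows "(\<integral>\<^sup>+x. rubio_de_francia K f x powre s * w x \<partial>lebesgue)
    \<le> ennreal (2 powr s) * (\<integral>\<^sup>+x. f x powre s * w x \<partial>lebesgue)"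
proof -
  let ?M = "maximal_op (\<lambda>_. 1)" and ?N = "\<integral>\<^sup>+x. f x powre s * w x \<partial>lebesgue"
  let ?c = "\<lambda>k. ennreal ((1 / 2) ^ k)"
  define b where "b k x = ennreal ((1 / K) ^ k) * (?M ^^ k) f x" for k x
  have [measurable]: "b k \<in> borel_measurable lebesgue" for k
    unfolding b_def[abs_def] by measurable
  have rdf: "rubio_de_francia K f x = (\<Sum>k. ?c k * b k x)" for x
  proof -
    have "?c k * ennreal ((1 / K) ^ k) = ennreal ((1 / (2 * K)) ^ k)" for k
      using K by (simp add: power_mult_distrib[symmetric] flip: ennreal_mult)
    then show ?thesis
      by (simp add: rubio_de_francia_def b_def mult.assoc[symmetric])
  qed
  have b_le: "(\<integral>\<^sup>+x. b k x powre s * w x \<partial>lebesgue) \<le> ?N" for k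
  proof -
    have "(\<integral>\<^sup>+x. b k x powre s * w x \<partial>lebesgue)
      = ennreal (((1 / K) ^ k) powr s) * (\<integral>\<^sup>+x. (?M ^^ k) f x powre s * w x \<partial>lebesgue)"
      using s K by (simp add: b_def powre_mult ennreal_powre mult.assoc nn_integral_cmult)
    also have "\<dots> \<le> ennreal (((1 / K) ^ k) powr s) * (ennreal ((K ^ k) powr s) * ?N)"
      by (intro mult_left_mono maximal_op_iterate_bounded K) auto
    also have "\<dots> = ?N"
    proof -
      have "((1 / K) ^ k) powr s * (K ^ k) powr s = 1"
        using K by (simp add: powr_mult[symmetric] power_mult_distrib[symmetric])
      then have "ennreal (((1 / K) ^ k) powr s) * ennreal ((K ^ k) powr s) = 1"
        by (simp flip: ennreal_mult)
      then show ?thesis by (simp add: mult.assoc[symmetric])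
    qed
    finally show ?thesis .
  qed
  have "(\<integral>\<^sup>+x. rubio_de_francia K f x powre s * w x \<partial>lebesgue)
    \<le> (\<integral>\<^sup>+x. ennreal (2 powr (s - 1)) * (\<Sum>k. ?c k * (b k x powre s * w x)) \<partial>lebesgue)"
  proof (rule nn_integral_mono)
    fix x
    have "rubio_de_francia K f x powre s * w x
      \<le> (ennreal (2 powr (s - 1)) * (\<Sum>k. ?c k * b k x powre s)) * w x"
      unfolding rdf by (intro mult_right_mono Jensen_geometric s) simp
    also have "\<dots> = ennreal (2 powr (s - 1)) * (\<Sum>k. ?c k * b k x powre s * w x)"
      by (subst ennreal_suminf_multc) (rule mult.assoc)
    finally show "rubio_de_francia K f x powre s * w x
      \<le> ennreal (2 powr (s - 1)) * (\<Sum>k. ?c k * (b k x powre s * w x))"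
      by (simp add: mult.assoc)
  qed
  also have "\<dots> = ennreal (2 powr (s - 1)) * (\<Sum>k. ?c k * (\<integral>\<^sup>+x. b k x powre s * w x \<partial>lebesgue))"
    by (simp add: nn_integral_cmult nn_integral_suminf del: ennreal_suminf_cmult)
  also have "\<dots> \<le> ennreal (2 powr (s - 1)) * (\<Sum>k. ?c k * ?N)"
    by (intro mult_left_mono suminf_le b_le) auto
  also have "\<dots> = ennreal (2 powr (s - 1)) * (2 * ?N)"
    using suminf_half_powers by simp
  also have "\<dots> = ennreal (2 powr s) * ?N"
  proof -
    have "ennreal (2 powr (s - 1)) * 2 = ennreal (2 powr s)"
      by (subst ennreal_numeral[symmetric], subst ennreal_mult[symmetric]) (auto simp: powr_diff)
    then show ?thesis by (simp add: mult.assoc[symmetric])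
  qed
  finally show ?thesis .
qed

end

section \<open>A_r weights from A_1 functions\<close>

lemma borel_measurable_locally_integrable:
  fixes w :: "'a::euclidean_space \<Rightarrow> real"
  assumes "locally_integrable_on w UNIV"
  shows "w \<in> borel_measurable lebesgue"
proof (rule borel_measurable_LIMSEQ_real)
  show "(\<lambda>n. indicator (cball 0 (real n)) x * w x) \<longlonglongrightarrow> w x" for x
  proof (rule tendsto_eventually)
    obtain m :: nat where m: "norm x \<le> real m" using real_arch_simple by blast
    have "indicator (cball 0 (real n)) x * w x = w x" if "m \<le> n" for n
    proof -
      have "x \<in> cball 0 (real n)" using m that by (auto intro: order.trans)
      then show ?thesis by simp
    qed
    then show "\<forall>\<^sub>F n in sequentially. indicator (cball 0 (real n)) x * w x = w x"
      by (auto simp: eventually_sequentially)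
  qed
  show "(\<lambda>x. indicator (cball 0 (real n)) x * w x) \<in> borel_measurable lebesgue" for n
    using assms borel_measurable_integrable[of lebesgue "\<lambda>x. indicator (cball 0 (real n)) x * w x"]
    by (auto simp: locally_integrable_on_def set_integrable_def)
qed

lemma weightI:
  fixes w :: "'a::euclidean_space \<Rightarrow> real"
  assumes [measurable]: "w \<in> borel_measurable lebesgue" and nonneg: "\<And>x. 0 \<le> w x"
    and fin: "\<And>r. (\<integral>\<^sup>+x\<in>ball 0 r. ennreal (w x) \<partial>lebesgue) < top"
  shows "weight w"
  unfolding weight_def locally_integrable_on_def
proof (intro conjI allI impI)
  fix K :: "'a set" assume K: "compact K \<and> K \<subseteq> UNIV"
  then obtain r where r: "K \<subseteq> ball 0 r"
    by (meson bounded_subset_ballD compact_imp_bounded)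
  have [measurable]: "K \<in> sets lebesgue"
    using K by (simp add: compact_imp_closed borel_closed)
  show "set_integrable lebesgue K w"
    unfolding set_integrable_def
  proof (rule integrableI_bounded)
    have "(\<integral>\<^sup>+x. ennreal (norm (indicator K x *\<^sub>R w x)) \<partial>lebesgue) \<le> (\<integral>\<^sup>+x\<in>ball 0 r. ennreal (w x) \<partial>lebesgue)"
      using r nonneg by (intro nn_integral_mono) (auto simp: indicator_def)
    with fin[of r] show "(\<integral>\<^sup>+x. ennreal (norm (indicator K x *\<^sub>R w x)) \<partial>lebesgue) < \<infinity>"
      by simp
  qed measurable
qed (rule nonneg)

lemma ball_average_le_cmult:
  assumes [measurable]: "g \<in> borel_measurable lebesgue"
    and "AE x in lebesgue. x \<in> ball c r \<longrightarrow> f x \<le> b * g x"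
  shows "ball_average c r f \<le> b * ball_average c r g"
proof -
  have "(\<integral>\<^sup>+x\<in>ball c r. f x \<partial>lebesgue) \<le> (\<integral>\<^sup>+x. b * (g x * indicator (ball c r) x) \<partial>lebesgue)"
    using assms(2) by (intro nn_integral_mono_AE) (auto elim!: eventually_mono simp: indicator_def)
  also have "\<dots> = b * (\<integral>\<^sup>+x\<in>ball c r. g x \<partial>lebesgue)"
    by (rule nn_integral_cmult) measurable
  finally show ?thesis
    unfolding ball_average_def ennreal_times_divide by (rule divide_right_mono_ennreal)
qed

lemma ball_average_pos:
  fixes f :: "'a::euclidean_space \<Rightarrow> ennreal"
  assumes [measurable]: "f \<in> borel_measurable lebesgue" and "\<And>x. 0 < f x" "0 < r"
  shows "0 < ball_average c r f"
proof -
  have "(\<integral>\<^sup>+x\<in>ball c r. f x \<partial>lebesgue) \<noteq> 0"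
    using set_nn_integral_ball_pos[OF assms, of c] by simp
  then show ?thesis
    using emeasure_lborel_ball_finite[of c r] by (simp add: ball_average_def ennreal_zero_less_divide less_le)
qed

text \<open>The easy direction of Jones' factorization theorem: \<open>H\<^sup>1\<^sup>-\<^sup>r a\<close> is an \<open>A\<^sub>r\<close> weight
  for \<open>A\<^sub>1\<close> weights \<open>H\<close> and \<open>a\<close>. The value 1 is put on the null set where \<open>H\<close> or \<open>a\<close> is infinite.\<close>

definition factor_weight :: "real \<Rightarrow> ('a \<Rightarrow> ennreal) \<Rightarrow> ('a \<Rightarrow> ennreal) \<Rightarrow> 'a \<Rightarrow> real"
  where "factor_weight r H a x =
    (if H x = top \<or> a x = top then 1 else enn2real (H x) powr (1 - r) * enn2real (a x))"

text \<open>The A_1 condition is read as a lower bound for \<open>H\<close> on the ball by its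
  average over \<open>L\<close>. The average is finite because the ball contains a point where
  \<open>H\<close> is finite.\<close>

lemma A1_average:
  fixes H :: "'a::euclidean_space \<Rightarrow> ennreal"
  assumes [measurable]: "H \<in> borel_measurable lebesgue" and pos: "\<And>x. 0 < H x"
    and fin: "AE x in lebesgue. H x < top"
    and A1: "\<And>x. x \<in> ball c \<rho> \<Longrightarrow> ball_average c \<rho> H \<le> ennreal L * H x" and "0 < \<rho>" "0 < L"
  obtains h where "0 < h" "ball_average c \<rho> H = ennreal h"
    "AE x in lebesgue. x \<in> ball c \<rho> \<longrightarrow> h / L \<le> enn2real (H x)"
proof -
  have "\<exists>x\<in>ball c \<rho>. H x < top"
  proof (rule ccontr)
    assume "\<not> ?thesis"
    with fin have "AE x in lebesgue. x \<notin> ball c \<rho>"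
      by (auto elim!: eventually_mono)
    then have "emeasure lebesgue (ball c \<rho>) = 0"
      by (subst (asm) AE_iff_measurable[where N = "ball c \<rho>"]) auto
    then show False
      using content_ball_pos[OF \<open>0 < \<rho>\<close>, of c] by (simp add: measure_def)
  qed
  then have "ball_average c \<rho> H < top"
    using A1 by (metis ennreal_mult_less_top ennreal_less_top le_less_trans)
  then obtain h where h: "ball_average c \<rho> H = ennreal h" "0 < h"
    using ball_average_pos[OF assms(1) pos \<open>0 < \<rho>\<close>, of c]
    by (metis ennreal_cases ennreal_less_zero_iff less_irrefl)
  have "AE x in lebesgue. x \<in> ball c \<rho> \<longrightarrow> h / L \<le> enn2real (H x)"
    using fin
  proof (rule eventually_mono, intro impI)
    fix x assume x: "H x < top" "x \<in> ball c \<rho>"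
    then obtain t where t: "H x = ennreal t" "0 \<le> t" by (metis less_top_ennreal)
    have "ennreal h \<le> ennreal (L * t)"
      using A1[OF x(2)] h t \<open>0 < L\<close> by (simp add: ennreal_mult)
    then show "h / L \<le> enn2real (H x)"
      using t \<open>0 < L\<close> by (simp add: field_simps)
  qed
  with h that show thesis by blast
qed

text \<open>In \<open>v = H^(1-r) a\<close> the power of \<open>H\<close> is negative, and in
  v^(-1/(r-1)) = H a^(-1/(r-1)) that of \<open>a\<close> is. By \<open>A1_average\<close> the
  negative powers are at most the same powers of average / \<open>L\<close>. In the A_r product the
  averages of \<open>H\<close> and \<open>a\<close> then cancel and leave L^(r-1) L.\<close>

lemma factor_weight_Ap:
  fixes H a :: "'a::euclidean_space \<Rightarrow> ennreal"
  assumes r: "1 < r" and L: "0 < L"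
    and [measurable]: "H \<in> borel_measurable lebesgue" "a \<in> borel_measurable lebesgue"
    and pos: "\<And>x. 0 < H x" "\<And>x. 0 < a x"
    and fin: "AE x in lebesgue. H x < top" "AE x in lebesgue. a x < top"
    and A1: "\<And>c \<rho> x. x \<in> ball c \<rho> \<Longrightarrow> ball_average c \<rho> H \<le> ennreal L * H x"
      "\<And>c \<rho> x. x \<in> ball c \<rho> \<Longrightarrow> ball_average c \<rho> a \<le> ennreal L * a x"
  shows "factor_weight r H a \<in> Ap_weights r" "Ap_const r (factor_weight r H a) \<le> ennreal (L powr r)"
proof -
  let ?v = "factor_weight r H a"
  have v_meas [measurable]: "?v \<in> borel_measurable lebesgue"
    unfolding factor_weight_def[abs_def] by measurable
  have v_pos: "0 < ?v x" for x
  proof (cases "H x = top \<or> a x = top")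
    case False
    then have "0 < enn2real (H x)" "0 < enn2real (a x)"
      using pos[of x] by (simp_all add: enn2real_positive_iff less_top)
    with False show ?thesis by (simp add: factor_weight_def)
  qed (simp add: factor_weight_def)
  have main: "ball_average c \<rho> (\<lambda>x. ennreal (?v x)) < top \<and>
    ball_average c \<rho> (\<lambda>x. ennreal (?v x)) *
       ennreal_powr (ball_average c \<rho> (\<lambda>x. inverse (ennreal (?v x powr (1 / (r - 1)))))) (r - 1)
      \<le> ennreal (L powr r)" if \<rho>: "0 < \<rho>" for c \<rho>
  proof -
    obtain h where h: "0 < h" "ball_average c \<rho> H = ennreal h"
      "AE x in lebesgue. x \<in> ball c \<rho> \<longrightarrow> h / L \<le> enn2real (H x)"
      using A1_average[of H c \<rho> L] pos fin A1 \<rho> L by (metis assms(3))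
    obtain \<alpha> where \<alpha>: "0 < \<alpha>" "ball_average c \<rho> a = ennreal \<alpha>"
      "AE x in lebesgue. x \<in> ball c \<rho> \<longrightarrow> \<alpha> / L \<le> enn2real (a x)"
      using A1_average[of a c \<rho> L] pos fin A1 \<rho> L by (metis assms(4))
    have 1: "ball_average c \<rho> (\<lambda>x. ennreal (?v x)) \<le> ennreal ((h / L) powr (1 - r)) * ball_average c \<rho> a"
    proof (rule ball_average_le_cmult)
      show "AE x in lebesgue. x \<in> ball c \<rho> \<longrightarrow> ennreal (?v x) \<le> ennreal ((h / L) powr (1 - r)) * a x"
        using fin h(3)
      proof eventually_elim
        case (elim x)
        show ?case
        proof
          assume x: "x \<in> ball c \<rho>"
          have "?v x \<le> (h / L) powr (1 - r) * enn2real (a x)"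
            using elim x r h L by (auto simp: factor_weight_def intro!: mult_right_mono powr_mono2')
          then have "ennreal (?v x) \<le> ennreal ((h / L) powr (1 - r) * enn2real (a x))"
            by (rule ennreal_leI)
          then show "ennreal (?v x) \<le> ennreal ((h / L) powr (1 - r)) * a x"
            using elim by (simp add: ennreal_mult)
        qed
      qed
    qed measurable
    have 2: "ball_average c \<rho> (\<lambda>x. inverse (ennreal (?v x powr (1 / (r - 1)))))
      \<le> ennreal ((\<alpha> / L) powr (- (1 / (r - 1)))) * ball_average c \<rho> H"
    proof (rule ball_average_le_cmult)
      show "AE x in lebesgue. x \<in> ball c \<rho> \<longrightarrow> inverse (ennreal (?v x powr (1 / (r - 1))))
        \<le> ennreal ((\<alpha> / L) powr (- (1 / (r - 1)))) * H x"
        using fin \<alpha>(3)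
      proof eventually_elim
        case (elim x)
        show ?case
        proof
          assume x: "x \<in> ball c \<rho>"
          have p: "0 < enn2real (H x)" "0 < enn2real (a x)"
            using pos[of x] elim by (auto simp: enn2real_positive_iff)
          have e: "(1 - r) * - (1 / (r - 1)) = 1" using r by (simp add: field_simps)
          have "inverse (ennreal (?v x powr (1 / (r - 1)))) = ennreal (?v x powr - (1 / (r - 1)))"
            using v_pos[of x] by (simp add: inverse_ennreal powr_minus)
          also have "?v x powr - (1 / (r - 1)) = enn2real (H x) * enn2real (a x) powr - (1 / (r - 1))"
            using elim p e by (auto simp: factor_weight_def powr_mult powr_powr)
          also have "\<dots> \<le> enn2real (H x) * (\<alpha> / L) powr - (1 / (r - 1))"
            using elim x r \<alpha> L by (intro mult_left_mono powr_mono2') auto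
          finally have "inverse (ennreal (?v x powr (1 / (r - 1))))
            \<le> ennreal (enn2real (H x) * (\<alpha> / L) powr - (1 / (r - 1)))"
            by (simp add: ennreal_leI)
          then show "inverse (ennreal (?v x powr (1 / (r - 1)))) \<le> ennreal ((\<alpha> / L) powr - (1 / (r - 1))) * H x"
            using elim by (simp add: ennreal_mult mult.commute)
        qed
      qed
    qed measurable
    have "ball_average c \<rho> (\<lambda>x. inverse (ennreal (?v x powr (1 / (r - 1))))) powre (r - 1)
      \<le> ennreal ((\<alpha> / L) powr (- (1 / (r - 1))) * h) powre (r - 1)"
      using 2 h r by (intro powre_mono) (auto simp: ennreal_mult)
    also have "\<dots> = ennreal (L / \<alpha> * h powr (r - 1))"
    proof -
      have "- (1 / (r - 1)) * (r - 1) = - 1" using r by simp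
      then have "((\<alpha> / L) powr (- (1 / (r - 1))) * h) powr (r - 1) = L / \<alpha> * h powr (r - 1)"
        using \<alpha> h L by (simp only: powr_mult powr_powr) (simp add: powr_neg_one)
      then show ?thesis using h by (simp add: ennreal_powre)
    qed
    finally have 3: "ball_average c \<rho> (\<lambda>x. inverse (ennreal (?v x powr (1 / (r - 1))))) powre (r - 1)
      \<le> ennreal (L / \<alpha> * h powr (r - 1))" .
    have 4: "ball_average c \<rho> (\<lambda>x. ennreal (?v x)) \<le> ennreal ((h / L) powr (1 - r) * \<alpha>)"
      using 1 \<alpha> by (simp add: ennreal_mult)
    have "(h / L) powr (1 - r) * \<alpha> * (L / \<alpha> * h powr (r - 1)) = L powr r"
    proof -
      have "(h / L) powr (1 - r) = L powr (r - 1) / h powr (r - 1)"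
        using h L powr_minus[of "h / L" "r - 1"] by (simp add: powr_divide)
      moreover have "L powr r = L powr (r - 1) * L" using L by (simp add: powr_diff)
      ultimately show ?thesis using h \<alpha> L by (simp add: field_simps)
    qed
    then have "ennreal ((h / L) powr (1 - r) * \<alpha>) * ennreal (L / \<alpha> * h powr (r - 1)) = ennreal (L powr r)"
      using \<alpha> L by (simp flip: ennreal_mult)
    then show ?thesis
      using mult_mono[OF 4 3] 4 by (auto intro: le_less_trans)
  qed
  show const: "Ap_const r ?v \<le> ennreal (L powr r)"
    unfolding Ap_const_def using main by (intro SUP_least) auto
  have "weight ?v"
  proof (rule weightI[OF v_meas])
    show "0 \<le> ?v x" for x using v_pos[of x] by simp
    show "(\<integral>\<^sup>+x\<in>ball 0 \<rho>. ennreal (?v x) \<partial>lebesgue) < top" for \<rho>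
    proof (cases "0 < \<rho>")
      case True
      have "(\<integral>\<^sup>+x\<in>ball 0 \<rho>. ennreal (?v x) \<partial>lebesgue) / emeasure lebesgue (ball (0::'a) \<rho>) < top"
        using main[OF True, of 0] by (simp add: ball_average_def)
      then show ?thesis
        using emeasure_lborel_ball_finite[of "0::'a" \<rho>] by (auto simp: less_top[symmetric] ennreal_top_divide)
    qed (simp add: ball_empty)
  qed
  with const show "?v \<in> Ap_weights r"
    by (auto simp: Ap_weights_def intro: le_less_trans)
qed

section \<open>Extrapolation\<close>

text \<open>Serves the case that \<open>G\<close> vanishes almost everywhere, where the algorithm
  yields no positive majorant.\<close>

lemma const_weight_Ap:
  assumes "1 < r" "1 \<le> L"
  shows "(\<lambda>_::'a::euclidean_space. 1) \<in> Ap_weights r" "Ap_const r (\<lambda>_::'a. 1) \<le> ennreal (L powr r)"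
proof -
  have one: "factor_weight r (\<lambda>_. 1) (\<lambda>_. 1) = (\<lambda>_::'a. 1)"
    by (simp add: factor_weight_def fun_eq_iff)
  have A1: "ball_average c \<rho> (\<lambda>_. 1) \<le> ennreal L * 1" if "x \<in> ball c \<rho>" for c x :: 'a and \<rho>
  proof -
    have "0 < \<rho>" using that by (metis ball_eq_empty empty_iff not_le)
    then have "ball_average c \<rho> (\<lambda>_. 1) = 1"
      using content_ball_pos[of \<rho> c] emeasure_lborel_ball_finite[of c \<rho>]
      by (auto simp: ball_average_def measure_def intro!: ennreal_divide_self)
    with assms show ?thesis by simp
  qed
  show "(\<lambda>_::'a. 1) \<in> Ap_weights r" "Ap_const r (\<lambda>_::'a. 1) \<le> ennreal (L powr r)"
    unfolding one[symmetric] using assms by (auto intro!: factor_weight_Ap A1)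
qed

section \<open>A_s weights as dual pairs\<close>

text \<open>On a ball with positive \<open>w\<close> mass the finite A_s product forces the average
  of the inverse power to be finite, and this power is infinite at zeros of \<open>w\<close>. Once
  one ball has positive mass, so do all larger concentric ones. The zero weight is a genuine
  exception because 0 * \<open>top\<close> = 0.\<close>

lemma Ap_weight_AE_pos:
  fixes w :: "'a::euclidean_space \<Rightarrow> real"
  assumes s: "1 < s" and w: "w \<in> Ap_weights s" and nz: "\<not> (AE x in lebesgue. w x = 0)"
  shows "AE x in lebesgue. 0 < w x"
proof -
  have w': "weight w" "Ap_const s w < top"
    using w by (simp_all add: Ap_weights_def)
  then have [measurable]: "w \<in> borel_measurable lebesgue" and nonneg: "\<And>x. 0 \<le> w x"
    by (simp_all add: weight_def borel_measurable_locally_integrable)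
  let ?B = "\<lambda>n. ball (0::'a) (real (Suc n))"
  have "\<exists>n. \<not> (AE x in lebesgue. ennreal (w x) * indicator (?B n) x = 0)"
  proof (rule ccontr)
    assume "\<not> ?thesis"
    then have "AE x in lebesgue. ennreal (w x) = 0"
      using AE_zero_if_zero_on_balls[of "\<lambda>x. ennreal (w x)" 0] by blast
    with nz nonneg show False by simp
  qed
  then obtain n where n: "\<not> (AE x in lebesgue. ennreal (w x) * indicator (?B n) x = 0)" by blast
  have fin: "AE x in lebesgue. x \<in> ?B m \<longrightarrow> 0 < w x" if "n \<le> m" for m
  proof -
    let ?inv = "\<lambda>x. inverse (ennreal (w x powr (1 / (s - 1))))"
    have "(\<integral>\<^sup>+x\<in>?B m. ennreal (w x) \<partial>lebesgue) \<noteq> 0"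
    proof
      assume "(\<integral>\<^sup>+x\<in>?B m. ennreal (w x) \<partial>lebesgue) = 0"
      then have "AE x in lebesgue. ennreal (w x) * indicator (?B m) x = 0"
        by (simp add: nn_integral_0_iff_AE)
      then have "AE x in lebesgue. ennreal (w x) * indicator (?B n) x = 0"
        using \<open>n \<le> m\<close> by (auto elim!: eventually_mono simp: indicator_def split: if_splits)
      with n show False by blast
    qed
    then have "ball_average 0 (real (Suc m)) (\<lambda>x. ennreal (w x)) \<noteq> 0"
      using emeasure_lborel_ball_finite[of "0::'a" "real (Suc m)"] by (simp add: ball_average_def)
    moreover have "ball_average 0 (real (Suc m)) (\<lambda>x. ennreal (w x)) *
       ball_average 0 (real (Suc m)) ?inv powre (s - 1) \<le> Ap_const s w"
      unfolding Ap_const_def by (rule SUP_upper2[of "(0, real (Suc m))"]) auto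
    ultimately have "ball_average 0 (real (Suc m)) ?inv < top"
      using w'(2) by (auto dest!: le_less_trans simp: ennreal_mult_less_top)
    then have "(\<integral>\<^sup>+x\<in>?B m. ?inv x \<partial>lebesgue) \<noteq> \<infinity>"
      using emeasure_lborel_ball_finite[of "0::'a" "real (Suc m)"]
      by (auto simp: ball_average_def ennreal_top_divide split: if_splits)
    then have "AE x in lebesgue. ?inv x * indicator (?B m) x \<noteq> \<infinity>"
      by (intro nn_integral_PInf_AE) auto
    then show ?thesis
      using nonneg by (auto elim!: eventually_mono simp: less_le)
  qed
  have "AE x in lebesgue. \<forall>m. x \<in> ?B (n + m) \<longrightarrow> 0 < w x"
    by (subst AE_all_countable, intro allI fin) simp
  then show ?thesis
  proof (rule eventually_mono)
    fix x assume *: "\<forall>m. x \<in> ?B (n + m) \<longrightarrow> 0 < w x"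
    obtain m :: nat where "norm x \<le> real m" using real_arch_simple by blast
    then have "x \<in> ?B (n + m)" by simp
    with * show "0 < w x" by blast
  qed
qed

lemma Ap_const_cong_AE:
  assumes "AE x in lebesgue. w x = w' x"
  shows "Ap_const s w = Ap_const s w'"
proof -
  have "ball_average c r (\<lambda>x. f (w x)) = ball_average c r (\<lambda>x. f (w' x))" for c r and f :: "real \<Rightarrow> ennreal"
    unfolding ball_average_def using assms
    by (intro arg_cong2[where f = "(/)"] nn_integral_cong_AE) (auto elim!: eventually_mono)
  from this[of _ _ ennreal] this[of _ _ "\<lambda>t. inverse (ennreal (t powr (1 / (s - 1))))"] show ?thesis
    unfolding Ap_const_def by simp
qed

text \<open>The s-th root of the A_s condition gives Q = T^(1/s); multiplying the volume N back in
  uses N^(1/s) N^(1/s') = N.\<close>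

lemma Ap_muckenhoupt_pair:
  fixes w :: "'a::euclidean_space \<Rightarrow> real"
  assumes s: "1 < s" and [measurable]: "w \<in> borel_measurable lebesgue" and pos: "\<And>x. 0 < w x"
    and T: "Ap_const s w \<le> ennreal T" "0 \<le> T"
  shows "muckenhoupt_pair s (s / (s - 1)) (T powr (1 / s)) (\<lambda>x. ennreal (w x))
    (\<lambda>x. inverse (ennreal (w x powr (1 / (s - 1)))))"
proof
  define s' where "s' = s / (s - 1)"
  show "1 / s + 1 / (s / (s - 1)) = 1" using s by (simp add: field_simps)
  then have s': "1 / s + 1 / s' = 1" "0 < s'" "1 / s' = (s - 1) / s"
    using s by (auto simp: s'_def)
  show "ennreal (w x) powre (1 / s) * inverse (ennreal (w x powr (1 / (s - 1)))) powre (1 / (s / (s - 1))) = 1" for x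
  proof -
    have "inverse (ennreal (w x powr (1 / (s - 1)))) = ennreal (w x powr - (1 / (s - 1)))"
      using pos[of x] by (simp add: inverse_ennreal powr_minus)
    moreover have "- (1 / (s - 1)) * (1 / (s / (s - 1))) = - (1 / s)"
      using s by (simp add: field_simps)
    ultimately have "inverse (ennreal (w x powr (1 / (s - 1)))) powre (1 / (s / (s - 1))) = ennreal (w x powr - (1 / s))"
      by (simp only: ennreal_powre powr_ge_zero powr_powr)
    then show ?thesis
      using pos[of x] by (simp add: ennreal_powre powr_minus flip: ennreal_mult)
  qed
  fix c :: 'a and r :: real assume r: "0 < r"
  let ?W = "\<integral>\<^sup>+y\<in>ball c r. ennreal (w y) \<partial>lebesgue" and ?N = "emeasure lebesgue (ball c r)"
  let ?V = "\<integral>\<^sup>+y\<in>ball c r. inverse (ennreal (w y powr (1 / (s - 1)))) \<partial>lebesgue"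
  have N: "?N \<noteq> 0" "?N \<noteq> top"
    using content_ball_pos[OF r, of c] emeasure_lborel_ball_finite[of c r] by (auto simp: measure_def)
  have "?W / ?N * (?V / ?N) powre (s - 1) \<le> ennreal T"
    using T(1) r unfolding Ap_const_def ball_average_def by (auto simp: SUP_le_iff)
  then have "(?W / ?N * (?V / ?N) powre (s - 1)) powre (1 / s) \<le> ennreal T powre (1 / s)"
    using s by (intro powre_mono) auto
  then have *: "(?W / ?N) powre (1 / s) * (?V / ?N) powre (1 / s') \<le> ennreal (T powr (1 / s))"
    using s T(2) by (simp add: powre_mult powre_powre ennreal_powre s')
  have "?W powre (1 / s) * ?V powre (1 / s') = (?W / ?N * ?N) powre (1 / s) * (?V / ?N * ?N) powre (1 / s')"
    using N by (simp add: ennreal_divide_times less_top)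
  also have "\<dots> = (?W / ?N) powre (1 / s) * (?V / ?N) powre (1 / s') * (?N powre (1 / s) * ?N powre (1 / s'))"
    using s s' by (simp add: powre_mult mult_ac)
  also have "?N powre (1 / s) * ?N powre (1 / s') = ?N"
    using s s' powre_add[of "1 / s" "1 / s'" ?N] by simp
  also have "(?W / ?N) powre (1 / s) * (?V / ?N) powre (1 / s') * ?N \<le> ennreal (T powr (1 / s)) * ?N"
    by (intro mult_right_mono *) simp
  finally show "?W powre (1 / s) * ?V powre (1 / (s / (s - 1))) \<le> ennreal (T powr (1 / s)) * ?N"
    by (simp add: s'_def)
qed (use s in auto)

section \<open>Extrapolation by duality\<close>

context muckenhoupt_pair
begin

lemma powre_mult_v: "w x powre s' * v x = w x"
proof -
  obtain a b where ab: "w x = ennreal a" "v x = ennreal b" "0 < a" "0 < b" "b = a powr (1 - s')"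
    by (rule weights_real)
  then have "a powr s' * b = a" by (simp flip: powr_add)
  with ab show ?thesis by (simp add: ennreal_powre flip: ennreal_mult)
qed

lemma AE_finite:
  assumes [measurable]: "f \<in> borel_measurable lebesgue" and "(\<integral>\<^sup>+x. f x powre s * w x \<partial>lebesgue) < top"
  shows "AE x in lebesgue. f x < top"
proof -
  have "AE x in lebesgue. f x powre s * w x \<noteq> \<infinity>"
    using assms(2) by (intro nn_integral_PInf_AE) auto
  then show ?thesis
  proof (rule eventually_mono)
    fix x assume "f x powre s * w x \<noteq> \<infinity>"
    then show "f x < top"
      using w_pos[of x] by (auto simp: less_top[symmetric] ennreal_mult_eq_top_iff)
  qed
qed

lemma Holder_weighted:
  assumes [measurable]: "f \<in> borel_measurable lebesgue" "g \<in> borel_measurable lebesgue"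
  shows "(\<integral>\<^sup>+x. f x * g x \<partial>lebesgue)
    \<le> (\<integral>\<^sup>+x. f x powre s * w x \<partial>lebesgue) powre (1 / s) * (\<integral>\<^sup>+x. g x powre s' * v x \<partial>lebesgue) powre (1 / s')"
proof -
  have "(\<integral>\<^sup>+x. f x * g x \<partial>lebesgue) = (\<integral>\<^sup>+x. (f x * w x powre (1 / s)) * (g x * v x powre (1 / s')) \<partial>lebesgue)"
  proof (rule nn_integral_cong)
    fix x
    have "(f x * w x powre (1 / s)) * (g x * v x powre (1 / s')) = f x * g x * (w x powre (1 / s) * v x powre (1 / s'))"
      by (simp only: mult_ac)
    then show "f x * g x = (f x * w x powre (1 / s)) * (g x * v x powre (1 / s'))"
      by (simp add: dual)
  qed
  also have "\<dots> \<le> (\<integral>\<^sup>+x. (f x * w x powre (1 / s)) powre s \<partial>lebesgue) powre (1 / s)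
      * (\<integral>\<^sup>+x. (g x * v x powre (1 / s')) powre s' \<partial>lebesgue) powre (1 / s')"
    by (intro nn_integral_Holder s) measurable
  finally show ?thesis
    using s s' by (simp add: powre_mult powre_powre)
qed

text \<open>The estimate at exponent \<open>r\<close> is applied to the weight \<open>H\<^sup>1\<^sup>-\<^sup>r a\<close>, where \<open>H\<close> majorizes \<open>G\<close> and
  \<open>a\<close> majorizes the dual function \<open>k\<close>; this works for both \<open>r \<le> s\<close> and \<open>r > s\<close>.\<close>

lemma extrapolation_dual:
  fixes F G k :: "'a \<Rightarrow> ennreal"
  assumes r: "1 < r" and C: "0 < C" and K: "1 \<le> K" "bound \<le> K"
    and meas [measurable]: "F \<in> borel_measurable lebesgue" "G \<in> borel_measurable lebesgue"
      "k \<in> borel_measurable lebesgue"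
    and hyp: "\<And>u. u \<in> Ap_weights r \<Longrightarrow> Ap_const r u \<le> ennreal ((2 * K) powr r) \<Longrightarrow>
      (\<integral>\<^sup>+x. F x powre r * ennreal (u x) \<partial>lebesgue) \<le> ennreal C * (\<integral>\<^sup>+x. G x powre r * ennreal (u x) \<partial>lebesgue)"
    and G: "\<not> (AE x in lebesgue. G x = 0)" "(\<integral>\<^sup>+x. G x powre s * w x \<partial>lebesgue) < top"
    and k: "\<not> (AE x in lebesgue. k x = 0)" "(\<integral>\<^sup>+x. k x powre s' * v x \<partial>lebesgue) < top"
  shows "(\<integral>\<^sup>+x. F x * k x \<partial>lebesgue) \<le> ennreal (4 * C powr (1 / r)) *
    ((\<integral>\<^sup>+x. G x powre s * w x \<partial>lebesgue) powre (1 / s) * (\<integral>\<^sup>+x. k x powre s' * v x \<partial>lebesgue) powre (1 / s'))"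
proof -
  define r' where "r' = r / (r - 1)"
  have r': "1 / r + 1 / r' = 1" "0 < r'" "1 / r' = (r - 1) / r"
    using r by (auto simp: r'_def field_simps)
  define H where "H = rubio_de_francia K G"
  define a where "a = rubio_de_francia K k"
  have [measurable]: "H \<in> borel_measurable lebesgue" "a \<in> borel_measurable lebesgue"
    unfolding H_def a_def by measurable
  have pos: "0 < H x" "0 < a x" for x
    unfolding H_def a_def using K G k by (auto intro!: rubio_de_francia_pos)
  have H_le: "(\<integral>\<^sup>+x. H x powre s * w x \<partial>lebesgue) \<le> ennreal (2 powr s) * (\<integral>\<^sup>+x. G x powre s * w x \<partial>lebesgue)"
    unfolding H_def by (intro rubio_de_francia_bounded K) measurable
  have "muckenhoupt_pair.bound TYPE('a) s' s Q \<le> K"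
    using K bound_swap by simp
  then have a_le: "(\<integral>\<^sup>+x. a x powre s' * v x \<partial>lebesgue) \<le> ennreal (2 powr s') * (\<integral>\<^sup>+x. k x powre s' * v x \<partial>lebesgue)"
    unfolding a_def by (intro muckenhoupt_pair.rubio_de_francia_bounded[OF swap] K) auto
  have fin: "AE x in lebesgue. H x < top" "AE x in lebesgue. a x < top"
  proof -
    have "(\<integral>\<^sup>+x. H x powre s * w x \<partial>lebesgue) < top"
      by (rule le_less_trans[OF H_le]) (simp add: ennreal_mult_less_top G)
    then show "AE x in lebesgue. H x < top" by (intro AE_finite) auto
    have "(\<integral>\<^sup>+x. a x powre s' * v x \<partial>lebesgue) < top"
      by (rule le_less_trans[OF a_le]) (simp add: ennreal_mult_less_top k)
    then show "AE x in lebesgue. a x < top" by (intro muckenhoupt_pair.AE_finite[OF swap]) auto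
  qed
  define u where "u = factor_weight r H a"
  have A1: "ball_average c \<rho> H \<le> ennreal (2 * K) * H x" "ball_average c \<rho> a \<le> ennreal (2 * K) * a x"
    if "x \<in> ball c \<rho>" for c \<rho> x
    unfolding H_def a_def using K that by (auto intro!: ball_average_rubio_de_francia)
  have u: "u \<in> Ap_weights r" "Ap_const r u \<le> ennreal ((2 * K) powr r)"
    unfolding u_def using K by (auto intro!: factor_weight_Ap r pos fin A1)
  have [measurable]: "u \<in> borel_measurable lebesgue"
    unfolding u_def factor_weight_def[abs_def] by measurable
  \<comment> \<open>These identities dictate the exponent 1 - r. The first splits F a into F u^(1/r)
    and (H a)^(1/r') for Hoelder's inequality; the second turns the right side of the hypothesis,
    with \<open>G\<close> replaced by \<open>H\<close>, into the same integral of H a.\<close>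
  have u_eq: "AE x in lebesgue. ennreal (u x) powre (1 / r) * (H x * a x) powre (1 / r') = a x \<and>
    H x powre r * ennreal (u x) = H x * a x"
    using fin
  proof eventually_elim
    case (elim x)
    obtain h where h: "H x = ennreal h" "0 < h"
      using elim pos(1)[of x] by (metis ennreal_cases ennreal_less_zero_iff less_irrefl)
    obtain \<alpha> where \<alpha>: "a x = ennreal \<alpha>" "0 < \<alpha>"
      using elim pos(2)[of x] by (metis ennreal_cases ennreal_less_zero_iff less_irrefl)
    have ux: "u x = h powr (1 - r) * \<alpha>"
      using h \<alpha> by (simp add: u_def factor_weight_def)
    have "(h powr (1 - r) * \<alpha>) powr (1 / r) * (h * \<alpha>) powr (1 / r')
      = h powr ((1 - r) / r + 1 / r') * \<alpha> powr (1 / r + 1 / r')"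
      using h \<alpha> by (simp add: powr_mult powr_powr powr_add mult_ac)
    also have "(1 - r) / r + 1 / r' = 0"
      using r r' by (simp add: field_simps)
    finally have 1: "(h powr (1 - r) * \<alpha>) powr (1 / r) * (h * \<alpha>) powr (1 / r') = \<alpha>"
      using h \<alpha> r' by simp
    have 2: "h powr r * (h powr (1 - r) * \<alpha>) = h * \<alpha>"
      using h by (simp add: mult.assoc[symmetric] powr_add[symmetric])
    from 1 2 show ?case
      using h \<alpha> by (simp add: ux ennreal_powre flip: ennreal_mult)
  qed
  let ?X = "\<integral>\<^sup>+x. H x * a x \<partial>lebesgue"
  have "(\<integral>\<^sup>+x. F x * k x \<partial>lebesgue) \<le> (\<integral>\<^sup>+x. F x * a x \<partial>lebesgue)"
    unfolding a_def by (intro nn_integral_mono mult_left_mono rubio_de_francia_ge) simp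
  also have "\<dots> = (\<integral>\<^sup>+x. (F x * ennreal (u x) powre (1 / r)) * (H x * a x) powre (1 / r') \<partial>lebesgue)"
    using u_eq by (intro nn_integral_cong_AE) (auto elim!: eventually_mono simp: mult.assoc)
  also have "\<dots> \<le> (\<integral>\<^sup>+x. (F x * ennreal (u x) powre (1 / r)) powre r \<partial>lebesgue) powre (1 / r)
      * (\<integral>\<^sup>+x. ((H x * a x) powre (1 / r')) powre r' \<partial>lebesgue) powre (1 / r')"
    by (intro nn_integral_Holder r r') measurable
  also have "\<dots> = (\<integral>\<^sup>+x. F x powre r * ennreal (u x) \<partial>lebesgue) powre (1 / r) * ?X powre (1 / r')"
    using r r'(2) by (simp add: powre_mult powre_powre)
  also have "\<dots> \<le> (ennreal C * ?X) powre (1 / r) * ?X powre (1 / r')"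
  proof (intro mult_right_mono powre_mono)
    have "(\<integral>\<^sup>+x. F x powre r * ennreal (u x) \<partial>lebesgue) \<le> ennreal C * (\<integral>\<^sup>+x. G x powre r * ennreal (u x) \<partial>lebesgue)"
      by (rule hyp[OF u])
    also have "\<dots> \<le> ennreal C * (\<integral>\<^sup>+x. H x powre r * ennreal (u x) \<partial>lebesgue)"
      unfolding H_def using r
      by (intro mult_left_mono nn_integral_mono mult_right_mono powre_mono rubio_de_francia_ge) auto
    also have "(\<integral>\<^sup>+x. H x powre r * ennreal (u x) \<partial>lebesgue) = ?X"
      using u_eq by (intro nn_integral_cong_AE) (auto elim!: eventually_mono)
    finally show "(\<integral>\<^sup>+x. F x powre r * ennreal (u x) \<partial>lebesgue) \<le> ennreal C * ?X" .
  qed (use r in auto)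
  also have "\<dots> = ennreal (C powr (1 / r)) * (?X powre (1 / r) * ?X powre (1 / r'))"
    using r C by (simp add: powre_mult ennreal_powre mult.assoc)
  also have "?X powre (1 / r) * ?X powre (1 / r') = ?X"
    using r r' powre_add[of "1 / r" "1 / r'" ?X] by simp
  also have "ennreal (C powr (1 / r)) * ?X \<le> ennreal (C powr (1 / r)) *
    ((ennreal (2 powr s) * (\<integral>\<^sup>+x. G x powre s * w x \<partial>lebesgue)) powre (1 / s)
      * (ennreal (2 powr s') * (\<integral>\<^sup>+x. k x powre s' * v x \<partial>lebesgue)) powre (1 / s'))"
    using s s' by (intro mult_left_mono order.trans[OF Holder_weighted[of H a]] mult_mono powre_mono H_le a_le) auto
  also have "\<dots> = ennreal (C powr (1 / r)) * (ennreal 2 * ennreal 2) *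
    ((\<integral>\<^sup>+x. G x powre s * w x \<partial>lebesgue) powre (1 / s) * (\<integral>\<^sup>+x. k x powre s' * v x \<partial>lebesgue) powre (1 / s'))"
    using s s' by (simp add: powre_mult ennreal_powre powr_powr mult_ac del: ennreal_numeral)
  \<comment> \<open>Passing from \<open>G\<close> to \<open>H\<close> and from \<open>k\<close> to
    \<open>a\<close> costs a factor 2 in norm each.\<close>
  also have "ennreal (C powr (1 / r)) * (ennreal 2 * ennreal 2) = ennreal (4 * C powr (1 / r))"
    by (simp add: mult.commute del: ennreal_numeral flip: ennreal_mult)
  finally show ?thesis .
qed

lemma extrapolation:
  fixes F G :: "'a \<Rightarrow> ennreal"
  assumes r: "1 < r" and C: "0 < C" and K: "1 \<le> K" "bound \<le> K"
    and meas [measurable]: "F \<in> borel_measurable lebesgue" "G \<in> borel_measurable lebesgue"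
    and F_fin: "\<And>x. F x < top"
    and hyp: "\<And>u. u \<in> Ap_weights r \<Longrightarrow> Ap_const r u \<le> ennreal ((2 * K) powr r) \<Longrightarrow>
      (\<integral>\<^sup>+x. F x powre r * ennreal (u x) \<partial>lebesgue) \<le> ennreal C * (\<integral>\<^sup>+x. G x powre r * ennreal (u x) \<partial>lebesgue)"
  shows "(\<integral>\<^sup>+x. F x powre s * w x \<partial>lebesgue)
    \<le> ennreal ((4 * C powr (1 / r)) powr s) * (\<integral>\<^sup>+x. G x powre s * w x \<partial>lebesgue)"
proof -
  let ?N = "\<integral>\<^sup>+x. G x powre s * w x \<partial>lebesgue" and ?A = "4 * C powr (1 / r)"
  consider "?N = top" | "AE x in lebesgue. G x = 0" | "?N < top" "\<not> (AE x in lebesgue. G x = 0)"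
    by (cases "?N = top") (auto simp: less_top[symmetric])
  then show ?thesis
  proof cases
    case 1
    have "0 < ?A powr s" using C by simp
    then show ?thesis by (simp add: 1 ennreal_mult_top)
  next
    case 2
    \<comment> \<open>The unweighted hypothesis makes \<open>F\<close> vanish almost
      everywhere.\<close>
    have "(\<integral>\<^sup>+x. F x powre r * ennreal 1 \<partial>lebesgue) \<le> ennreal C * (\<integral>\<^sup>+x. G x powre r * ennreal 1 \<partial>lebesgue)"
      using K const_weight_Ap[OF r, of "2 * K"] by (intro hyp) auto
    also have "(\<integral>\<^sup>+x. G x powre r * ennreal 1 \<partial>lebesgue) = 0"
      using 2 by (simp add: nn_integral_0_iff_AE)
    finally have "AE x in lebesgue. F x = 0"
      by (simp add: nn_integral_0_iff_AE)
    then have "(\<integral>\<^sup>+x. F x powre s * w x \<partial>lebesgue) = 0"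
      by (subst nn_integral_0_iff_AE) (auto elim!: eventually_mono)
    then show ?thesis by simp
  next
    case 3
    define B where "B n = ball (0::'a) (real n)" for n
    \<comment> \<open>Cutting \<open>F\<close> off in height and in space makes \<integral> m^s w
      finite, because \<open>w\<close> has finite mass on balls.\<close>
    define m where "m n x = min (F x) (of_nat n) * indicator (B n) x" for n x
    have [measurable]: "B n \<in> sets lebesgue" for n unfolding B_def by measurable
    have [measurable]: "m n \<in> borel_measurable lebesgue" for n unfolding m_def[abs_def] by measurable
    have m_le: "m n x \<le> F x" for n x by (auto simp: m_def indicator_def)
    have trunc: "(\<integral>\<^sup>+x. m n x powre s * w x \<partial>lebesgue) \<le> ennreal (?A powr s) * ?N" for n
    proof -
      let ?I = "\<integral>\<^sup>+x. m n x powre s * w x \<partial>lebesgue"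
      \<comment> \<open>The extremal function of duality: k^s' v = m^s w, while F k \<ge> m^s
        w.\<close>
      define k where "k x = m n x powre (s - 1) * w x" for x
      have [measurable]: "k \<in> borel_measurable lebesgue" unfolding k_def[abs_def] by measurable
      have "?I \<le> (\<integral>\<^sup>+x. of_nat n powre s * (w x * indicator (B n) x) \<partial>lebesgue)"
        using s by (intro nn_integral_mono)
          (auto simp: m_def indicator_def intro!: mult_right_mono powre_mono)
      also have "\<dots> = of_nat n powre s * (\<integral>\<^sup>+x\<in>B n. w x \<partial>lebesgue)"
        by (rule nn_integral_cmult) measurable
      also have "\<dots> < top"
        using ball_w_finite[of 0 "real n"] by (simp add: ennreal_mult_less_top B_def of_nat_less_top)
      finally have I_fin: "?I < top" .
      have I_eq: "(\<integral>\<^sup>+x. k x powre s' * v x \<partial>lebesgue) = ?I"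
      proof (rule nn_integral_cong)
        fix x
        have "(s - 1) * s' = s" using s by (simp add: s'_eq)
        then show "k x powre s' * v x = m n x powre s * w x"
          using s' powre_mult_v[of x] by (simp add: k_def powre_mult powre_powre mult.assoc)
      qed
      show ?thesis
      proof (cases "?I = 0")
        case False
        have "\<not> (AE x in lebesgue. k x = 0)"
        proof
          assume "AE x in lebesgue. k x = 0"
          then have "(\<integral>\<^sup>+x. k x powre s' * v x \<partial>lebesgue) = 0"
            by (subst nn_integral_0_iff_AE) (auto elim!: eventually_mono)
          with False I_eq show False by simp
        qed
        then have "(\<integral>\<^sup>+x. F x * k x \<partial>lebesgue) \<le> ennreal ?A * (?N powre (1 / s) * ?I powre (1 / s'))"
          using extrapolation_dual[OF r C K, of F G k] hyp 3 I_eq I_fin by simp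
        moreover have "?I \<le> (\<integral>\<^sup>+x. F x * k x \<partial>lebesgue)"
        proof (rule nn_integral_mono)
          fix x
          have "m n x powre s = m n x * m n x powre (s - 1)"
            using s powre_add[of 1 "s - 1" "m n x"] by simp
          then show "m n x powre s * w x \<le> F x * k x"
            using mult_right_mono[OF m_le[of n x], of "m n x powre (s - 1) * w x"]
            by (simp add: k_def mult.assoc)
        qed
        moreover have "?I = ?I powre (1 / s') * ?I powre (1 / s)"
          using s s' powre_add[of "1 / s'" "1 / s" ?I] by (simp add: add.commute)
        ultimately have "?I powre (1 / s') * ?I powre (1 / s) \<le> ?I powre (1 / s') * (ennreal ?A * ?N powre (1 / s))"
          by (simp add: mult_ac)
        \<comment> \<open>The factor I^(1/s') may be cancelled since 0 < I <
          \<open>top\<close>.\<close>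
        then have "?I powre (1 / s) \<le> ennreal ?A * ?N powre (1 / s)"
          using False I_fin by (subst (asm) ennreal_mult_le_mult_iff) auto
        then have "(?I powre (1 / s)) powre s \<le> (ennreal ?A * ?N powre (1 / s)) powre s"
          using s by (intro powre_mono) auto
        then show ?thesis
          using s C by (simp add: powre_powre powre_mult ennreal_powre)
      qed simp
    qed
    have "(\<integral>\<^sup>+x. F x powre s * w x \<partial>lebesgue) \<le> (\<integral>\<^sup>+x. (SUP n. m n x powre s * w x) \<partial>lebesgue)"
    proof (rule nn_integral_mono)
      fix x
      \<comment> \<open>As F x is finite, the truncation at \<open>x\<close> is exact from some
        index on.\<close>
      obtain i where i: "F x < of_nat i" using ennreal_Ex_less_of_nat[OF F_fin] by blast
      obtain j :: nat where j: "norm x < real j" using reals_Archimedean2 by blast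
      have "of_nat i \<le> (of_nat (i + j) :: ennreal)" by (intro of_nat_mono) simp
      with i have "F x \<le> of_nat (i + j)" by (meson less_le_trans order.strict_implies_order)
      moreover have "x \<in> B (i + j)" using j by (simp add: B_def)
      ultimately have "m (i + j) x = F x" by (simp add: m_def min_def)
      then show "F x powre s * w x \<le> (SUP n. m n x powre s * w x)"
        by (intro SUP_upper2[of "i + j"]) auto
    qed
    also have "\<dots> = (SUP n. \<integral>\<^sup>+x. m n x powre s * w x \<partial>lebesgue)"
    proof (rule nn_integral_monotone_convergence_SUP)
      have "m n x \<le> m n' x" if "n \<le> n'" for n n' x
      proof -
        have "(of_nat n :: ennreal) \<le> of_nat n'" using that by (intro of_nat_mono)
        moreover have "B n \<subseteq> B n'" using that by (auto simp: B_def)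
        ultimately show ?thesis
          unfolding m_def by (intro mult_mono min.mono) (auto simp: indicator_def)
      qed
      then show "incseq (\<lambda>n x. m n x powre s * w x)"
        using s by (auto simp: incseq_def le_fun_def intro!: mult_right_mono powre_mono)
    qed measurable
    also have "\<dots> \<le> ennreal (?A powr s) * ?N"
      by (intro SUP_least trunc)
    finally show ?thesis .
  qed
qed

end

section \<open>Weighted gradient estimates\<close>

text \<open>The constant is chosen before the domain, the functions and the weight; of the weight it
  knows only the bound \<open>T\<close>.\<close>

lemma weighted_estimate_extrapolation:
  fixes p q T :: real and C :: "real \<Rightarrow> real"
  assumes p: "1 < p" and q: "p - 1 < q" and T: "0 \<le> T"
    and C: "mono_on {0..} C" "\<forall>t\<ge>0. 0 \<le> C t"
  shows "\<exists>C'\<ge>0. \<forall>(\<Omega> :: (real^'n::finite) set) f u w.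
    open \<Omega> \<longrightarrow> f \<in> borel_measurable (lebesgue_on \<Omega>) \<longrightarrow> weak_grad \<Omega> u \<in> borel_measurable (lebesgue_on \<Omega>) \<longrightarrow>
    weighted_estimate p (p / (p - 1)) C \<Omega> f u \<longrightarrow>
    w \<in> Ap_weights (q / (p - 1)) \<longrightarrow> Ap_const (q / (p - 1)) w \<le> ennreal T \<longrightarrow>
    (\<integral>\<^sup>+x\<in>\<Omega>. ennreal (norm (weak_grad \<Omega> u x) powr q * w x) \<partial>lebesgue)
      \<le> ennreal C' * (\<integral>\<^sup>+x\<in>\<Omega>. ennreal (norm (f x) powr q * w x) \<partial>lebesgue)"
proof -
  define r where "r = p / (p - 1)"
  define s where "s = q / (p - 1)"
  have r: "1 < r" "(p - 1) * r = p" and s: "1 < s" "(p - 1) * s = q"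
    using p q by (auto simp: r_def s_def field_simps)
  define K where "K = max 1 (muckenhoupt_pair.bound TYPE(real^'n) s (s / (s - 1)) (T powr (1 / s)))"
  have K: "1 \<le> K" "muckenhoupt_pair.bound TYPE(real^'n) s (s / (s - 1)) (T powr (1 / s)) \<le> K"
    by (auto simp: K_def)
  define L where "L = (2 * K) powr r"
  \<comment> \<open>Monotonicity bounds C(.) by C L for every weight that the extrapolation uses.
    The 1 makes the constant positive, so that its product with an infinite right side stays
    infinite.\<close>
  define C\<^sub>0 where "C\<^sub>0 = C L + 1"
  have C\<^sub>0: "0 < C\<^sub>0" using C(2) by (simp add: C\<^sub>0_def L_def add_nonneg_pos)
  show ?thesis
    unfolding r_def[symmetric] s_def[symmetric]
  proof (intro exI[of _ "(4 * C\<^sub>0 powr (1 / r)) powr s"] conjI allI impI)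
    fix \<Omega> :: "(real^'n) set" and f and u w :: "real^'n \<Rightarrow> real"
    assume \<Omega>: "open \<Omega>" and f: "f \<in> borel_measurable (lebesgue_on \<Omega>)"
      and g: "weak_grad \<Omega> u \<in> borel_measurable (lebesgue_on \<Omega>)"
      and est: "weighted_estimate p r C \<Omega> f u"
      and w: "w \<in> Ap_weights s" "Ap_const s w \<le> ennreal T"
    \<comment> \<open>Extension by zero carries the problem from \<Omega> to the whole space, where
      the maximal operator acts; powers keep the indicator since
      \<open>0 powre t = 0\<close>.\<close>
    define \<Phi> where "\<Phi> h x = ennreal (norm (h x) powr (p - 1)) * indicator \<Omega> x" for h :: "real^'n \<Rightarrow> real^'n" and x
    have \<Phi>_meas: "\<Phi> h \<in> borel_measurable lebesgue" if "h \<in> borel_measurable (lebesgue_on \<Omega>)" for h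
    proof -
      have "(\<lambda>x. ennreal (norm (h x) powr (p - 1))) \<in> borel_measurable (lebesgue_on \<Omega>)"
        using that by measurable
      then show ?thesis
        unfolding \<Phi>_def[abs_def] using \<Omega>
        by (subst borel_measurable_restrict_space_iff_ennreal[symmetric]) (auto simp: borel_open)
    qed
    have \<Phi>: "\<Phi> h x powre e * ennreal b = ennreal (norm (h x) powr ((p - 1) * e) * b) * indicator \<Omega> x" for h x e b
      by (auto simp: \<Phi>_def indicator_def ennreal_powre powr_powr ennreal_mult')
    have wm [measurable]: "w \<in> borel_measurable lebesgue" and w0: "\<And>x. 0 \<le> w x"
      using w(1) by (simp_all add: Ap_weights_def weight_def borel_measurable_locally_integrable)
    show "(\<integral>\<^sup>+x\<in>\<Omega>. ennreal (norm (weak_grad \<Omega> u x) powr q * w x) \<partial>lebesgue)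
      \<le> ennreal ((4 * C\<^sub>0 powr (1 / r)) powr s) * (\<integral>\<^sup>+x\<in>\<Omega>. ennreal (norm (f x) powr q * w x) \<partial>lebesgue)"
    proof (cases "AE x in lebesgue. w x = 0")
      case True
      then have "AE x in lebesgue. ennreal (norm (weak_grad \<Omega> u x) powr q * w x) * indicator \<Omega> x = 0"
        by (auto elim!: eventually_mono)
      from nn_integral_cong_AE[OF this] have "(\<integral>\<^sup>+x\<in>\<Omega>. ennreal (norm (weak_grad \<Omega> u x) powr q * w x) \<partial>lebesgue) = 0"
        by simp
      then show ?thesis by simp
    next
      case False
      \<comment> \<open>A dual pair needs positivity at every point, so the null set of zeros is
        filled with 1; neither the integrals nor the A_s constant change.\<close>
      define w' where "w' x = (if 0 < w x then w x else 1)" for x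
      have eq: "AE x in lebesgue. w x = w' x"
        using Ap_weight_AE_pos[OF s(1) w(1) False] by (auto elim!: eventually_mono simp: w'_def)
      have [measurable]: "w' \<in> borel_measurable lebesgue"
        unfolding w'_def[abs_def] by measurable
      have "muckenhoupt_pair s (s / (s - 1)) (T powr (1 / s)) (\<lambda>x. ennreal (w' x))
        (\<lambda>x. inverse (ennreal (w' x powr (1 / (s - 1)))))"
        using w(2) s(1) T Ap_const_cong_AE[OF eq, of s]
        by (intro Ap_muckenhoupt_pair) (auto simp: w'_def)
      then have *: "(\<integral>\<^sup>+x. \<Phi> (weak_grad \<Omega> u) x powre s * ennreal (w' x) \<partial>lebesgue)
        \<le> ennreal ((4 * C\<^sub>0 powr (1 / r)) powr s) * (\<integral>\<^sup>+x. \<Phi> f x powre s * ennreal (w' x) \<partial>lebesgue)"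
      proof (rule muckenhoupt_pair.extrapolation[OF _ r(1) C\<^sub>0 K \<Phi>_meas[OF g] \<Phi>_meas[OF f]])
        show "\<Phi> (weak_grad \<Omega> u) x < top" for x
          by (simp add: \<Phi>_def indicator_def)
        fix v :: "real^'n \<Rightarrow> real" assume v: "v \<in> Ap_weights r" "Ap_const r v \<le> ennreal ((2 * K) powr r)"
        have "enn2real (Ap_const r v) \<le> L"
          using v(2) by (intro enn2real_leI) (auto simp: L_def)
        then have "C (enn2real (Ap_const r v)) \<le> C\<^sub>0"
          using mono_onD[OF C(1), of "enn2real (Ap_const r v)" L] by (simp add: C\<^sub>0_def L_def)
        then have "ennreal (C (enn2real (Ap_const r v))) * (\<integral>\<^sup>+x\<in>\<Omega>. ennreal (norm (f x) powr p * v x) \<partial>lebesgue)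
          \<le> ennreal C\<^sub>0 * (\<integral>\<^sup>+x\<in>\<Omega>. ennreal (norm (f x) powr p * v x) \<partial>lebesgue)"
          by (intro mult_right_mono ennreal_leI) auto
        then have "(\<integral>\<^sup>+x\<in>\<Omega>. ennreal (norm (weak_grad \<Omega> u x) powr p * v x) \<partial>lebesgue)
          \<le> ennreal C\<^sub>0 * (\<integral>\<^sup>+x\<in>\<Omega>. ennreal (norm (f x) powr p * v x) \<partial>lebesgue)"
          using est v(1) unfolding weighted_estimate_def by (blast intro: order.trans)
        then show "(\<integral>\<^sup>+x. \<Phi> (weak_grad \<Omega> u) x powre r * ennreal (v x) \<partial>lebesgue)
          \<le> ennreal C\<^sub>0 * (\<integral>\<^sup>+x. \<Phi> f x powre r * ennreal (v x) \<partial>lebesgue)"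
          by (simp only: \<Phi> r)
      qed
      have "(\<integral>\<^sup>+x\<in>\<Omega>. ennreal (norm (h x) powr q * w x) \<partial>lebesgue)
        = (\<integral>\<^sup>+x. \<Phi> h x powre s * ennreal (w' x) \<partial>lebesgue)" for h :: "real^'n \<Rightarrow> real^'n"
        unfolding \<Phi> s(2) using eq by (intro nn_integral_cong_AE) (auto elim!: eventually_mono)
      with * show ?thesis by simp
    qed
  qed simp
qed

theorem theorem1p8:
  fixes p q :: real and C :: "real \<Rightarrow> real"
  assumes "1 < p" and "p - 1 < q"
    and "mono_on {0..} C" and "\<forall>t\<ge>0. 0 \<le> C t"
  shows "\<exists>C' :: real \<Rightarrow> real. mono_on {0..} C' \<and> (\<forall>t\<ge>0. 0 \<le> C' t) \<and>
    (\<forall>(\<Omega> :: (real^'n::finite) set) A f u.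
       open \<Omega> \<and> connected \<Omega> \<and> \<Omega> \<noteq> {} \<and> bounded \<Omega> \<and>
       structural_assumptions p A \<and>
       f \<in> Lp_on \<Omega> p \<and>
       weak_solution p \<Omega> A f u \<and>
       weighted_estimate p (p / (p - 1)) C \<Omega> f u \<longrightarrow>
       weighted_estimate q (q / (p - 1)) C' \<Omega> f u)"
proof -
  let ?s = "q / (p - 1)"
  \<comment> \<open>Integer bounds for the weight constant suffice, so the choice function has a
    countable domain.\<close>
  have "\<forall>n::nat. \<exists>c\<ge>0. \<forall>(\<Omega> :: (real^'n::finite) set) f u w.
    open \<Omega> \<longrightarrow> f \<in> borel_measurable (lebesgue_on \<Omega>) \<longrightarrow> weak_grad \<Omega> u \<in> borel_measurable (lebesgue_on \<Omega>) \<longrightarrow>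
    weighted_estimate p (p / (p - 1)) C \<Omega> f u \<longrightarrow> w \<in> Ap_weights ?s \<longrightarrow> Ap_const ?s w \<le> ennreal (real n) \<longrightarrow>
    (\<integral>\<^sup>+x\<in>\<Omega>. ennreal (norm (weak_grad \<Omega> u x) powr q * w x) \<partial>lebesgue)
      \<le> ennreal c * (\<integral>\<^sup>+x\<in>\<Omega>. ennreal (norm (f x) powr q * w x) \<partial>lebesgue)"
    using assms by (intro allI weighted_estimate_extrapolation) auto
  from choice[OF this] obtain c where c: "\<And>n. 0 \<le> c n"
    and est: "\<And>n (\<Omega> :: (real^'n) set) f u w. open \<Omega> \<Longrightarrow> f \<in> borel_measurable (lebesgue_on \<Omega>) \<Longrightarrow>
      weak_grad \<Omega> u \<in> borel_measurable (lebesgue_on \<Omega>) \<Longrightarrow>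
      weighted_estimate p (p / (p - 1)) C \<Omega> f u \<Longrightarrow> w \<in> Ap_weights ?s \<Longrightarrow> Ap_const ?s w \<le> ennreal (real n) \<Longrightarrow>
      (\<integral>\<^sup>+x\<in>\<Omega>. ennreal (norm (weak_grad \<Omega> u x) powr q * w x) \<partial>lebesgue)
        \<le> ennreal (c n) * (\<integral>\<^sup>+x\<in>\<Omega>. ennreal (norm (f x) powr q * w x) \<partial>lebesgue)"
    by blast
  \<comment> \<open>The chosen constants need not increase with n; summing them does. Rounding up
    ensures that the weight constant lies below the index used.\<close>
  define C' where "C' t = (\<Sum>k\<le>nat \<lceil>t\<rceil>. c k)" for t :: real
  show ?thesis
  proof (intro exI[of _ C'] conjI allI impI)
    show "mono_on {0..} C'"
      unfolding C'_def using c by (intro mono_onI sum_mono2) (auto intro: order.trans[OF _ le_of_int_ceiling])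
    show "0 \<le> C' t" for t unfolding C'_def using c by (intro sum_nonneg) auto
    fix \<Omega> :: "(real^'n) set" and A f u
    assume H: "open \<Omega> \<and> connected \<Omega> \<and> \<Omega> \<noteq> {} \<and> bounded \<Omega> \<and> structural_assumptions p A \<and>
       f \<in> Lp_on \<Omega> p \<and> weak_solution p \<Omega> A f u \<and> weighted_estimate p (p / (p - 1)) C \<Omega> f u"
    then have meas: "f \<in> borel_measurable (lebesgue_on \<Omega>)" "weak_grad \<Omega> u \<in> borel_measurable (lebesgue_on \<Omega>)"
      by (auto simp: weak_solution_def sobolev_W1_0_def sobolev_W1_def Lp_on_def)
    show "weighted_estimate q ?s C' \<Omega> f u"
      unfolding weighted_estimate_def
    proof
      fix w :: "real^'n \<Rightarrow> real" assume w: "w \<in> Ap_weights ?s"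
      define n where "n = nat \<lceil>enn2real (Ap_const ?s w)\<rceil>"
      have "Ap_const ?s w = ennreal (enn2real (Ap_const ?s w))"
        using w by (simp add: Ap_weights_def)
      also have "\<dots> \<le> ennreal (real n)"
        unfolding n_def by (intro ennreal_leI) linarith
      finally have le: "(\<integral>\<^sup>+x\<in>\<Omega>. ennreal (norm (weak_grad \<Omega> u x) powr q * w x) \<partial>lebesgue)
        \<le> ennreal (c n) * (\<integral>\<^sup>+x\<in>\<Omega>. ennreal (norm (f x) powr q * w x) \<partial>lebesgue)"
        using H meas w by (intro est) auto
      have "c n \<le> C' (enn2real (Ap_const ?s w))"
        unfolding C'_def n_def using c by (intro member_le_sum) auto
      then have "ennreal (c n) * (\<integral>\<^sup>+x\<in>\<Omega>. ennreal (norm (f x) powr q * w x) \<partial>lebesgue)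
        \<le> ennreal (C' (enn2real (Ap_const ?s w))) * (\<integral>\<^sup>+x\<in>\<Omega>. ennreal (norm (f x) powr q * w x) \<partial>lebesgue)"
        by (intro mult_right_mono ennreal_leI) auto
      with le show "(\<integral>\<^sup>+x\<in>\<Omega>. ennreal (norm (weak_grad \<Omega> u x) powr q * w x) \<partial>lebesgue)
        \<le> ennreal (C' (enn2real (Ap_const ?s w))) * (\<integral>\<^sup>+x\<in>\<Omega>. ennreal (norm (f x) powr q * w x) \<partial>lebesgue)"
        by (rule order.trans)
    qed
  qed
qed

end
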